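(* For all decision problems $L_1,L_2\subseteq\Sigma^*$, if $L_1\le^{NC}_{fcr}L_2$ and $L_2$ can be made $\sqcap'$-tractable, then $L_1$ can be made $\sqcap'$-tractable.
   Context: $\Sigma$ is a finite alphabet; a decision problem is a language $L\subseteq\Sigma^*$. An NC function is one computable on a PRAM in $\log^{O(1)}n$ time with $n^{O(1)}$ processors; a language of pairs $S\subseteq\Sigma^*\times\Sigma^*$ is in NC if deciding $\langle D,Q\rangle\in S$ is in NC. A language of pairs $S$ (with $|Q|\in O(\mathrm{polylog}(|D|))$ for all $\langle D,Q\rangle\in S$) is $\sqcap'$-tractable if there exist a polynomial-time computable function $\Pi:\Sigma^*\to\Sigma^*$ with $|\Pi(x)|\in O(\mathrm{polylog}(|x|))$ for all $x$, and a language of pairs $S'$ in NC, such that for all $D,Q\in\Sigma^*$: $\langle D,Q\rangle\in S$ iff $\langle\Pi(D),Q\rangle\in S'$. A cr-factorization of $L$ is a tuple $\Upsilon=(\pi_1,\pi_2,\rho,c)$ with $\pi_1,\pi_2,\rho$ NC functions and $c$ a constant such that for all $x\in L$: $\rho(\pi_1(x),\pi_2(x))=x$, $|\pi_1(x)|+|\pi_2(x)|\le|x|+c$, $|\pi_2(x)|\in O(\mathrm{polylog}(|\pi_1(x)|))$; $S_{(L,\Upsilon)}=\{\langle\pi_1(x),\pi_2(x)\rangle:x\in L\}$. $L$ can be made $\sqcap'$-tractable if there is a cr-factorization $\Upsilon$ of $L$ with $S_{(L,\Upsilon)}$ $\sqcap'$-tractable. $L_1\le^{NC}_{fcr}L_2$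 means there exist cr-factorizations $\Upsilon_1$ of $L_1$ and $\Upsilon_2$ of $L_2$ and NC functions $\alpha,\beta$ with $\langle D,Q\rangle\in S_{(L_1,\Upsilon_1)}$ iff $\langle\alpha(D),\beta(Q)\rangle\in S_{(L_2,\Upsilon_2)}$ for all $D,Q\in\Sigma^*$. *)

theory Defs
  imports Complex_Main
begin

section \<open>Parallel random access machines\<close>

text \<open>
  A PRAM is a synchronous collection of random access machines that all run the same program and
  communicate through a shared memory. Every processor has its own program counter and
  its own registers. The arithmetic is addition and truncated subtraction, without
  multiplication, so that a word grows by at most one bit per step and unit cost is
  realistic: polynomial time on one processor is polynomial time on Turing machines.
\<close>

datatype instr =
    Const nat nat        \<comment> \<open>\<open>Const r k\<close>: \<open>r := k\<close>\<close>
  | Add nat nat nat      \<comment> \<open>\<open>Add r s t\<close>: \<open>r := s + t\<close>\<close>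
  | Sub nat nat nat      \<comment> \<open>\<open>Sub r s t\<close>: \<open>r := s - t\<close>, truncated at \<open>0\<close>\<close>
  | Load nat nat         \<comment> \<open>\<open>Load r s\<close>: \<open>r := mem[s]\<close>\<close>
  | Store nat nat        \<comment> \<open>\<open>Store r s\<close>: \<open>mem[r] := s\<close>\<close>
  | JumpZero nat nat     \<comment> \<open>\<open>JumpZero r l\<close>: if \<open>r = 0\<close> then continue at address \<open>l\<close>\<close>

type_synonym program = "instr list"
type_synonym memory = "nat \<Rightarrow> nat"
type_synonym processor = "nat \<times> (nat \<Rightarrow> nat)"  \<comment> \<open>program counter and registers\<close>
type_synonym config = "(nat \<Rightarrow> processor) \<times> memory"

text \<open>A processor halts when its program counter leaves the program.\<close>

definition proc_halted :: "program \<Rightarrow> processor \<Rightarrow> bool" where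
  "proc_halted P s \<longleftrightarrow> length P \<le> fst s"

fun exec_instr :: "memory \<Rightarrow> instr \<Rightarrow> processor \<Rightarrow> processor" where
  "exec_instr M (Const r k) (pc, R) = (Suc pc, R(r := k))"
| "exec_instr M (Add r s t) (pc, R) = (Suc pc, R(r := R s + R t))"
| "exec_instr M (Sub r s t) (pc, R) = (Suc pc, R(r := R s - R t))"
| "exec_instr M (Load r s) (pc, R) = (Suc pc, R(r := M (R s)))"
| "exec_instr M (Store r s) (pc, R) = (Suc pc, R)"
| "exec_instr M (JumpZero r l) (pc, R) = (if R r = 0 then l else Suc pc, R)"

definition proc_step :: "program \<Rightarrow> memory \<Rightarrow> processor \<Rightarrow> processor" where
  "proc_step P M s = (if proc_halted P s then s else exec_instr M (P ! fst s) s)"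

definition writes :: "program \<Rightarrow> processor \<Rightarrow> nat \<Rightarrow> nat \<Rightarrow> bool" where
  "writes P s a v \<longleftrightarrow>
     \<not> proc_halted P s \<and> (\<exists>r t. P ! fst s = Store r t \<and> snd s r = a \<and> snd s t = v)"

text \<open>
  Reads see the memory before the step. Concurrent access is allowed, and on a write conflict the
  processor with the least index wins; the class NC does not depend on the conflict rule.
\<close>

definition mem_step :: "program \<Rightarrow> nat \<Rightarrow> config \<Rightarrow> memory" where
  "mem_step P p c a =
     (if \<exists>i<p. \<exists>v. writes P (fst c i) a v
      then THE v. writes P (fst c (LEAST i. i < p \<and> (\<exists>v. writes P (fst c i) a v))) a v
      else snd c a)"

definition pram_step :: "program \<Rightarrow> nat \<Rightarrow> config \<Rightarrow> config" where
  "pram_step P p c =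
     (\<lambda>i. if i < p then proc_step P (snd c) (fst c i) else fst c i, mem_step P p c)"

text \<open>Initially register \<open>0\<close> of a processor holds its index, all other registers are \<open>0\<close>.\<close>

definition init_config :: "memory \<Rightarrow> config" where
  "init_config M = (\<lambda>i. (0, (\<lambda>_. 0)(0 := i)), M)"

text \<open>On \<open>p\<close> processors, \<open>P\<close> halts after at most \<open>t\<close> steps and turns memory \<open>M\<close> into \<open>M'\<close>.\<close>

definition pram_run :: "program \<Rightarrow> nat \<Rightarrow> nat \<Rightarrow> memory \<Rightarrow> memory \<Rightarrow> bool" where
  "pram_run P p t M M' \<longleftrightarrow>
     (\<exists>t'\<le>t. let c = (pram_step P p ^^ t') (init_config M)
             in (\<forall>i<p. proc_halted P (fst c i)) \<and> snd c = M')"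

section \<open>Words\<close>

text \<open>
  A word is stored with its length in cell \<open>0\<close> and its symbols in the cells from \<open>1\<close> on.
  The input memory is blank (\<open>0\<close>) elsewhere; in the output memory the other cells are arbitrary.
\<close>

definition input_memory :: "nat list \<Rightarrow> memory" where
  "input_memory w a =
     (if a = 0 then length w else if a \<le> length w then w ! (a - 1) else 0)"

definition output_memory :: "memory \<Rightarrow> nat list \<Rightarrow> bool" where
  "output_memory M w \<longleftrightarrow> M 0 = length w \<and> (\<forall>i<length w. M (Suc i) = w ! i)"

text \<open>
  The alphabet is the finite type \<^typ>\<open>'a\<close>. Its symbols get the numbers from \<open>2\<close> on; \<open>0\<close> is the
  blank and \<open>1\<close> separates the components of a pair.
\<close>

definition sym_code :: "'a::finite \<Rightarrow> nat" where
  "sym_code = (SOME f. bij_betw f UNIV {2..card (UNIV :: 'a set) + 1})"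

definition enc_word :: "'a::finite list \<Rightarrow> nat list" where
  "enc_word w = map sym_code w"

definition enc_pair :: "'a::finite list \<times> 'a list \<Rightarrow> nat list" where
  "enc_pair DQ = enc_word (fst DQ) @ [1] @ enc_word (snd DQ)"

definition enc_bool :: "bool \<Rightarrow> nat list" where
  "enc_bool b = (if b then [1] else [])"

section \<open>Complexity classes\<close>

text \<open>
  \<open>f(x) \<in> O(polylog(g(x)))\<close> and \<open>f(x) \<in> g(x)^O(1)\<close> for \<open>x \<in> A\<close>. Adding \<open>2\<close> keeps the bounds
  at least \<open>1\<close> for small \<open>g(x)\<close>, so that they can be required for all \<open>x \<in> A\<close>.
\<close>

definition polylog_bounded :: "'x set \<Rightarrow> ('x \<Rightarrow> nat) \<Rightarrow> ('x \<Rightarrow> nat) \<Rightarrow> bool" where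
  "polylog_bounded A f g \<longleftrightarrow>
     (\<exists>(C::real) (e::nat). \<forall>x\<in>A. real (f x) \<le> C * log 2 (real (g x) + 2) ^ e)"

definition poly_bounded :: "'x set \<Rightarrow> ('x \<Rightarrow> nat) \<Rightarrow> ('x \<Rightarrow> nat) \<Rightarrow> bool" where
  "poly_bounded A f g \<longleftrightarrow>
     (\<exists>(C::real) (e::nat). \<forall>x\<in>A. real (f x) \<le> C * (real (g x) + 2) ^ e)"

text \<open>
  The number of processors is \<open>(n + 2)^k\<close> for input length \<open>n\<close>, rather than an arbitrary
  polynomially bounded function of \<open>n\<close>: the program can find out how many processors there are,
  so an arbitrary function could supply non-uniform advice.
\<close>

definition nc_computable :: "('i \<Rightarrow> nat list) \<Rightarrow> ('o \<Rightarrow> nat list) \<Rightarrow> ('i \<Rightarrow> 'o) \<Rightarrow> bool" where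
  "nc_computable ein eout f \<longleftrightarrow>
     (\<exists>P k time. polylog_bounded UNIV time (\<lambda>x. length (ein x)) \<and>
        (\<forall>x. \<exists>M. pram_run P ((length (ein x) + 2) ^ k) (time x) (input_memory (ein x)) M \<and>
                 output_memory M (eout (f x))))"

definition nc_fun :: "('a::finite list \<Rightarrow> 'a list) \<Rightarrow> bool" where
  "nc_fun f \<longleftrightarrow> nc_computable enc_word enc_word f"

definition nc_fun2 :: "('a::finite list \<Rightarrow> 'a list \<Rightarrow> 'a list) \<Rightarrow> bool" where
  "nc_fun2 f \<longleftrightarrow> nc_computable enc_pair enc_word (\<lambda>(x, y). f x y)"

definition nc_pair_language :: "('a::finite list \<times> 'a list) set \<Rightarrow> bool" where
  "nc_pair_language S \<longleftrightarrow> nc_computable enc_pair enc_bool (\<lambda>DQ. DQ \<in> S)"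

text \<open>Polynomial time is time \<open>n^O(1)\<close> on a single random access machine.\<close>

definition poly_time_fun :: "('a::finite list \<Rightarrow> 'a list) \<Rightarrow> bool" where
  "poly_time_fun f \<longleftrightarrow>
     (\<exists>P time. poly_bounded UNIV time (length :: 'a list \<Rightarrow> nat) \<and>
        (\<forall>x. \<exists>M. pram_run P 1 (time x) (input_memory (enc_word x)) M \<and>
                 output_memory M (enc_word (f x))))"

section \<open>Tractability, factorizations and reductions\<close>

definition sqcap'_tractable :: "('a::finite list \<times> 'a list) set \<Rightarrow> bool" where
  "sqcap'_tractable S \<longleftrightarrow>
     polylog_bounded S (\<lambda>(D, Q). length Q) (\<lambda>(D, Q). length D) \<and>
     (\<exists>\<Pi> S'. poly_time_fun \<Pi> \<and>
             polylog_bounded UNIV (\<lambda>x. length (\<Pi> x)) length \<and>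
             nc_pair_language S' \<and>
             (\<forall>D Q. (D, Q) \<in> S \<longleftrightarrow> (\<Pi> D, Q) \<in> S'))"

type_synonym 'a factorization =
  "('a list \<Rightarrow> 'a list) \<times> ('a list \<Rightarrow> 'a list) \<times> ('a list \<Rightarrow> 'a list \<Rightarrow> 'a list) \<times> nat"

fun cr_factorization :: "'a::finite list set \<Rightarrow> 'a factorization \<Rightarrow> bool" where
  "cr_factorization L (\<pi>1, \<pi>2, \<rho>, c) \<longleftrightarrow>
     nc_fun \<pi>1 \<and> nc_fun \<pi>2 \<and> nc_fun2 \<rho> \<and>
     (\<forall>x\<in>L. \<rho> (\<pi>1 x) (\<pi>2 x) = x) \<and>
     (\<forall>x\<in>L. length (\<pi>1 x) + length (\<pi>2 x) \<le> length x + c) \<and>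
     polylog_bounded L (\<lambda>x. length (\<pi>2 x)) (\<lambda>x. length (\<pi>1 x))"

fun pair_language :: "'a list set \<Rightarrow> 'a factorization \<Rightarrow> ('a list \<times> 'a list) set" where
  "pair_language L (\<pi>1, \<pi>2, \<rho>, c) = {(\<pi>1 x, \<pi>2 x) | x. x \<in> L}"

definition can_be_made_tractable :: "'a::finite list set \<Rightarrow> bool" where
  "can_be_made_tractable L \<longleftrightarrow>
     (\<exists>\<Upsilon>. cr_factorization L \<Upsilon> \<and> sqcap'_tractable (pair_language L \<Upsilon>))"

definition nc_fcr_reducible :: "'a::finite list set \<Rightarrow> 'a list set \<Rightarrow> bool" where
  "nc_fcr_reducible L1 L2 \<longleftrightarrow>
     (\<exists>\<Upsilon>1 \<Upsilon>2 \<alpha> \<beta>. cr_factorization L1 \<Upsilon>1 \<and> cr_factorization L2 \<Upsilon>2 \<and> nc_fun \<alpha> \<and> nc_fun \<beta> \<and>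
        (\<forall>D Q. (D, Q) \<in> pair_language L1 \<Upsilon>1 \<longleftrightarrow> (\<alpha> D, \<beta> Q) \<in> pair_language L2 \<Upsilon>2))"

end

theory Submission
  imports Defs
begin

text \<open>
  A language can be made tractable iff it is decidable in polynomial time. If \<open>L\<close> is decidable, the
  factorization \<open>x = \<rho> x []\<close> puts all of \<open>x\<close> into the data part, and the preprocessing can already
  compute the answer. Conversely, \<open>x \<in> L\<close> holds iff \<open>\<rho> (\<pi>1 x) (\<pi>2 x) = x\<close> and \<open>(\<pi>1 x, \<pi>2 x)\<close>
  is in the pair language, which the preprocessing followed by the NC test decides. A reduction from
  \<open>L1\<close> to \<open>L2\<close> yields in the same way a polynomial-time algorithm for \<open>L1\<close>, where the two
  factorizations of \<open>L2\<close> need not agree, since \<open>\<rho>\<close> of the first one recovers the word that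
  the second one splits.

  The work is in the closure of single-processor polynomial time under composition and PRAM
  simulation. It is done for programs over registers and infinitely many arrays whose loops are
  bounded, so that they are total functions. A bounded loop suffices to simulate a PRAM because a
  halted configuration no longer changes.
\<close>

section \<open>Loop programs\<close>

text \<open>Composing the preprocessing of \<open>L2\<close> with \<alpha> does not work when the
  tractable factorization of \<open>L2\<close> differs from that of the reduction: passing from a
  pair of one to a pair of the other takes \<open>\<rho>\<close>, hence also the query, which the
  preprocessing does not see. So the given factorization of \<open>L1\<close> only serves to decide
  \<open>L1\<close> and is then replaced. In the new one the query is empty and the preprocessed
  data has length at most 1, which makes every polylogarithmic bound trivial.

  The remaining difficulty is the machine. It has neither multiplication nor arrays: powers are
  computed by iterated addition, and arrays are interleaved in one memory with a stride fixed at
  compile time. The input arrives without gaps and must first be moved to this stride in place.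
  Composition also needs bounds on the lengths of intermediate words. A time bound alone gives none
  for the number in a length cell, since an addition can double it in every step.\<close>

datatype com =
    SetC nat nat
  | AddC nat nat nat
  | SubC nat nat nat
  | Get nat nat nat
  | Put nat nat nat
  | Seq com com  (infixr ";;" 60)
  | For nat com

type_synonym state = "(nat \<Rightarrow> nat) \<times> (nat \<Rightarrow> nat \<Rightarrow> nat)"

text \<open>The counter drops before the body runs, so a loop entered with \<open>n\<close> sees
  \<open>n - 1\<close>, ..., \<open>0\<close> if the body leaves the counter alone; these are the
  indices of \<open>n\<close> processors or symbols.\<close>

definition dec :: "nat \<Rightarrow> state \<Rightarrow> state" where
  "dec r s = ((fst s)(r := fst s r - 1), snd s)"

primrec run :: "com \<Rightarrow> state \<Rightarrow> state" where
  "run (SetC r k) s = ((fst s)(r := k), snd s)"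
| "run (AddC r a b) s = ((fst s)(r := fst s a + fst s b), snd s)"
| "run (SubC r a b) s = ((fst s)(r := fst s a - fst s b), snd s)"
| "run (Get r j a) s = ((fst s)(r := snd s j (fst s a)), snd s)"
| "run (Put j a b) s = (fst s, (snd s)(j := (snd s j)(fst s a := fst s b)))"
| "run (c ;; d) s = run d (run c s)"
| "run (For r c) s = ((\<lambda>s. run c (dec r s)) ^^ fst s r) s"

text \<open>One unit pays for \<open>K + 3\<close> machine steps: an array access takes
  \<open>K + 2\<close>, and the overhead of one loop round is 3. The leading 1 of a loop is the test
  that leaves it.\<close>

primrec cost :: "com \<Rightarrow> state \<Rightarrow> nat" where
  "cost (SetC r k) s = 1"
| "cost (AddC r a b) s = 1"
| "cost (SubC r a b) s = 1"
| "cost (Get r j a) s = 1"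
| "cost (Put j a b) s = 1"
| "cost (c ;; d) s = cost c s + cost d (run c s)"
| "cost (For r c) s =
     1 + (\<Sum>k<fst s r. 1 + cost c (dec r (((\<lambda>s. run c (dec r s)) ^^ k) s)))"

primrec assigned :: "com \<Rightarrow> nat set" where
  "assigned (SetC r k) = {r}"
| "assigned (AddC r a b) = {r}"
| "assigned (SubC r a b) = {r}"
| "assigned (Get r j a) = {r}"
| "assigned (Put j a b) = {}"
| "assigned (c ;; d) = assigned c \<union> assigned d"
| "assigned (For r c) = insert r (assigned c)"

text \<open>Reads count as well, because this set determines the stride of the compiled code;
  framing only needs \<open>updated\<close>.\<close>

primrec arrays :: "com \<Rightarrow> nat set" where
  "arrays (SetC r k) = {}"
| "arrays (AddC r a b) = {}"
| "arrays (SubC r a b) = {}"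
| "arrays (Get r j a) = {j}"
| "arrays (Put j a b) = {j}"
| "arrays (c ;; d) = arrays c \<union> arrays d"
| "arrays (For r c) = arrays c"

primrec updated :: "com \<Rightarrow> nat set" where
  "updated (SetC r k) = {}"
| "updated (AddC r a b) = {}"
| "updated (SubC r a b) = {}"
| "updated (Get r j a) = {}"
| "updated (Put j a b) = {j}"
| "updated (c ;; d) = updated c \<union> updated d"
| "updated (For r c) = updated c"

text \<open>\<open>run\<close> fixes the number of rounds on entry, the machine tests the counter
  again in every round. Both agree when the body does not assign the counter.\<close>

primrec wf_com :: "com \<Rightarrow> bool" where
  "wf_com (SetC r k) = True"
| "wf_com (AddC r a b) = True"
| "wf_com (SubC r a b) = True"
| "wf_com (Get r j a) = True"
| "wf_com (Put j a b) = True"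
| "wf_com (c ;; d) = (wf_com c \<and> wf_com d)"
| "wf_com (For r c) = (r \<notin> assigned c \<and> wf_com c)"

lemma dec_simps [simp]: "fst (dec r s) r = fst s r - 1" "x \<noteq> r \<Longrightarrow> fst (dec r s) x = fst s x"
  "snd (dec r s) = snd s"
  by (auto simp: dec_def)

lemma run_unassigned: "r \<notin> assigned c \<Longrightarrow> fst (run c s) r = fst s r"
proof (induction c arbitrary: s)
  case (For q c)
  have "fst (((\<lambda>s. run c (dec q s)) ^^ n) s) r = fst s r" for n
    by (induction n) (use For in auto)
  then show ?case by simp
qed auto

lemma run_not_updated: "j \<notin> updated c \<Longrightarrow> snd (run c s) j = snd s j"
proof (induction c arbitrary: s)
  case (For q c)
  have "snd (((\<lambda>s. run c (dec q s)) ^^ n) s) j = snd s j" for n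
    by (induction n) (use For in auto)
  then show ?case by simp
qed auto

lemma updated_subset_arrays: "updated c \<subseteq> arrays c"
  by (induction c) auto

text \<open>Since the body keeps the counter, what remains after one round is the same loop with one
  round less. The loop rule and the compiled code both proceed in this form.\<close>

lemma For_Suc:
  assumes "r \<notin> assigned c" "fst s r = Suc n"
  shows "run (For r c) s = run (For r c) (run c (dec r s))"
    "cost (For r c) s = 1 + cost c (dec r s) + cost (For r c) (run c (dec r s))"
proof -
  have n: "fst (run c (dec r s)) r = n"
    using assms by (simp add: run_unassigned)
  show "run (For r c) s = run (For r c) (run c (dec r s))"
    unfolding run.simps n assms(2) by (simp add: funpow_Suc_right del: funpow.simps)
  show "cost (For r c) s = 1 + cost c (dec r s) + cost (For r c) (run c (dec r s))"
    unfolding cost.simps n assms(2)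
    by (simp add: sum.lessThan_Suc_shift funpow_Suc_right del: sum.lessThan_Suc funpow.simps(2))
qed

text \<open>The invariant is indexed by the number of rounds still to come; every round has the same
  cost bound \<open>b\<close>, so result and running time follow from one induction.\<close>

lemma For_rule:
  assumes "r \<notin> assigned c"
    and "I (fst s r) s"
    and "\<And>k s. I (Suc k) s \<Longrightarrow> fst s r = Suc k \<Longrightarrow>
           I k (run c (dec r s)) \<and> cost c (dec r s) \<le> b"
  shows "I 0 (run (For r c) s)" "cost (For r c) s \<le> 1 + fst s r * (1 + b)"
proof -
  have "I 0 (run (For r c) s) \<and> cost (For r c) s \<le> 1 + n * (1 + b)" if "I n s" "fst s r = n" for n
    using that
  proof (induction n arbitrary: s)
    case 0
    then show ?case by simp
  next
    case (Suc n)
    let ?s = "run c (dec r s)"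
    have "fst ?s r = n"
      using Suc.prems assms(1) by (simp add: run_unassigned)
    with Suc.IH[of ?s] assms(3)[OF Suc.prems] For_Suc[OF assms(1) Suc.prems(2)]
    show ?case by (auto simp del: run.simps cost.simps)
  qed
  then show "I 0 (run (For r c) s)" "cost (For r c) s \<le> 1 + fst s r * (1 + b)"
    using assms(2) by blast+
qed

section \<open>Compilation to a single processor\<close>

definition store_effect :: "program \<Rightarrow> processor \<Rightarrow> memory \<Rightarrow> memory" where
  "store_effect P s M =
     (if proc_halted P s then M
      else case P ! fst s of Store r t \<Rightarrow> M(snd s r := snd s t) | _ \<Rightarrow> M)"

lemma store_effect_writes:
  "store_effect P s M a = (if \<exists>v. writes P s a v then THE v. writes P s a v else M a)"
  by (auto simp: store_effect_def writes_def split: instr.split)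

lemma mem_step_0: "mem_step P 0 c = snd c"
  by (auto simp: mem_step_def)

text \<open>As the least index wins a conflict, the stores of a step can be carried out one at a
  time from the highest index down, later ones overwriting earlier ones. A loop counting down thus
  resolves conflicts without searching for them.\<close>

lemma mem_step_Suc:
  "mem_step P (Suc p) (S, M) = mem_step P p (S, store_effect P (S p) M)"
proof
  fix a
  let ?W = "\<lambda>i. \<exists>v. writes P (S i) a v"
  show "mem_step P (Suc p) (S, M) a = mem_step P p (S, store_effect P (S p) M) a"
  proof (cases "\<exists>i<p. ?W i")
    case True
    then obtain i where i: "i < p" "?W i" by blast
    have "(LEAST i. i < Suc p \<and> ?W i) = (LEAST i. i < p \<and> ?W i)"
    proof (rule Least_equality)
      show "(LEAST i. i < p \<and> ?W i) < Suc p \<and> ?W (LEAST i. i < p \<and> ?W i)"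
        using LeastI[of "\<lambda>i. i < p \<and> ?W i" i] i by auto
      fix y assume "y < Suc p \<and> ?W y"
      then show "(LEAST i. i < p \<and> ?W i) \<le> y"
        using Least_le[of "\<lambda>i. i < p \<and> ?W i" y] Least_le[of "\<lambda>i. i < p \<and> ?W i" i] i
        by (cases "y < p") auto
    qed
    moreover have "\<exists>i<Suc p. ?W i" using i less_SucI by blast
    ultimately show ?thesis using True by (simp add: mem_step_def)
  next
    case False
    then have F: "?W i \<Longrightarrow> i < Suc p \<Longrightarrow> i = p" for i
      by (metis less_Suc_eq)
    show ?thesis
    proof (cases "?W p")
      case True
      then have "(LEAST i. i < Suc p \<and> ?W i) = p"
        by (intro Least_equality) (use F in auto)
      then show ?thesis using True False
        by (auto simp: mem_step_def store_effect_writes)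
    next
      case W: False
      then have "\<not> (\<exists>i<Suc p. ?W i)" using F by blast
      then show ?thesis using W False
        by (auto simp: mem_step_def store_effect_writes)
    qed
  qed
qed

section \<open>Runs of a single processor\<close>

definition ram_step :: "program \<Rightarrow> processor \<times> memory \<Rightarrow> processor \<times> memory" where
  "ram_step P x = (proc_step P (snd x) (fst x), store_effect P (fst x) (snd x))"

lemma pram_step_one:
  "(fst (pram_step P 1 c) 0, snd (pram_step P 1 c)) = ram_step P (fst c 0, snd c)"
  using mem_step_Suc[of P 0 "fst c" "snd c"]
  by (simp add: pram_step_def ram_step_def mem_step_0)

lemma pram_steps_one:
  "(fst ((pram_step P 1 ^^ t) c) 0, snd ((pram_step P 1 ^^ t) c)) = (ram_step P ^^ t) (fst c 0, snd c)"
proof (induction t)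
  case (Suc t)
  then show ?case using pram_step_one[of P "(pram_step P 1 ^^ t) c"] by simp
qed simp

definition reaches :: "program \<Rightarrow> nat \<Rightarrow> processor \<times> memory \<Rightarrow> processor \<times> memory \<Rightarrow> bool" where
  "reaches P t x y \<longleftrightarrow> (\<exists>t'\<le>t. (ram_step P ^^ t') x = y)"

lemma reaches_refl: "reaches P 0 x x"
  by (simp add: reaches_def)

lemma reaches_step: "reaches P t (ram_step P x) y \<Longrightarrow> reaches P (Suc t) x y"
  unfolding reaches_def by (metis Suc_le_mono funpow_swap1 funpow.simps(2) comp_apply)

lemma reaches_trans: "reaches P t x y \<Longrightarrow> reaches P u y z \<Longrightarrow> reaches P (t + u) x z"
  unfolding reaches_def
proof (elim exE conjE)
  fix t' u' assume *: "t' \<le> t" "(ram_step P ^^ t') x = y" "u' \<le> u" "(ram_step P ^^ u') y = z"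
  then have "(ram_step P ^^ (u' + t')) x = z" by (simp add: funpow_add)
  with * show "\<exists>t'\<le>t + u. (ram_step P ^^ t') x = z" by (intro exI[of _ "u' + t'"]) auto
qed

lemma reaches_mono: "reaches P t x y \<Longrightarrow> t \<le> u \<Longrightarrow> reaches P u x y"
  unfolding reaches_def using order_trans by blast

lemma reaches_one: "ram_step P x = y \<Longrightarrow> reaches P 1 x y"
  unfolding reaches_def by (intro exI[of _ 1]) simp

section \<open>Code fragments and the layout of arrays in memory\<close>

definition code_at :: "program \<Rightarrow> nat \<Rightarrow> program \<Rightarrow> bool" where
  "code_at P b C \<longleftrightarrow> (\<forall>i<length C. b + i < length P \<and> P ! (b + i) = C ! i)"

lemma code_at_Cons:
  "code_at P b (x # C) \<longleftrightarrow> b < length P \<and> P ! b = x \<and> code_at P (Suc b) C"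
  unfolding code_at_def by (auto simp: nth_Cons less_Suc_eq_0_disj split: nat.split)

lemma code_at_Nil: "code_at P b []"
  by (simp add: code_at_def)

lemma code_at_append:
  "code_at P b (C @ D) \<longleftrightarrow> code_at P b C \<and> code_at P (b + length C) D"
  by (induction C arbitrary: b) (auto simp: code_at_Cons code_at_Nil)

lemma code_at_infix: "code_at (U @ C @ V) (length U) C"
  by (auto simp: code_at_def nth_append)

text \<open>
  Register 0 stays 0, so that \<open>JumpZero 0\<close> is an unconditional jump; register 1 holds 1 and register 2
  the address of an array access. Entry \<open>i\<close> of array \<open>j\<close> is the memory cell \<open>i * K + j\<close>, where
  all arrays in use have numbers below \<open>K\<close>. In particular, for \<open>K = 1\<close> array 0 is the memory itself.
\<close>

primrec compile :: "nat \<Rightarrow> nat \<Rightarrow> com \<Rightarrow> program" where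
  "compile K b (SetC r k) = [Const (r + 3) k]"
| "compile K b (AddC r s t) = [Add (r + 3) (s + 3) (t + 3)]"
| "compile K b (SubC r s t) = [Sub (r + 3) (s + 3) (t + 3)]"
| "compile K b (Get r j s) = Const 2 j # replicate K (Add 2 2 (s + 3)) @ [Load (r + 3) 2]"
| "compile K b (Put j r s) = Const 2 j # replicate K (Add 2 2 (r + 3)) @ [Store 2 (s + 3)]"
| "compile K b (c ;; d) = compile K b c @ compile K (b + length (compile K b c)) d"
| "compile K b (For r c) =
     JumpZero (r + 3) (b + 3 + length (compile K (b + 2) c)) # Sub (r + 3) (r + 3) 1
       # compile K (b + 2) c @ [JumpZero 0 b]"

text \<open>Register 2 and the arrays from \<open>K\<close> on are left free. The same machine
  configuration can therefore be read as different states when the stride changes between code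
  fragments.\<close>

definition represents :: "nat \<Rightarrow> (nat \<Rightarrow> nat) \<Rightarrow> memory \<Rightarrow> state \<Rightarrow> bool" where
  "represents K \<rho> M s \<longleftrightarrow> \<rho> 0 = 0 \<and> \<rho> 1 = 1 \<and> (\<forall>r. \<rho> (r + 3) = fst s r) \<and>
     (\<forall>j<K. \<forall>i. M (i * K + j) = snd s j i)"

lemma ram_step_eq:
  assumes "pc < length P"
  shows "ram_step P ((pc, \<rho>), M) =
    (exec_instr M (P ! pc) (pc, \<rho>), case P ! pc of Store r t \<Rightarrow> M(\<rho> r := \<rho> t) | _ \<Rightarrow> M)"
  using assms by (cases "P ! pc") (auto simp: ram_step_def proc_step_def store_effect_def proc_halted_def)

text \<open>Multiplying the index by the constant \<open>K\<close> is done by \<open>K\<close>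
  additions in a row; the index must not sit in the accumulator, register 2.\<close>

lemma reaches_address:
  assumes "code_at P b (Const 2 j # replicate K (Add 2 2 s))" "s \<noteq> 2"
  shows "reaches P (Suc K) ((b, \<rho>), M) ((b + Suc K, \<rho>(2 := \<rho> s * K + j)), M)"
proof -
  have adds: "reaches P k ((pc, \<rho>), M) ((pc + k, \<rho>(2 := \<rho> 2 + \<rho> s * k)), M)"
    if "code_at P pc (replicate k (Add 2 2 s))" for k pc \<rho>
    using that
  proof (induction k arbitrary: pc \<rho>)
    case 0
    then show ?case by (simp add: reaches_refl)
  next
    case (Suc k)
    then have *: "pc < length P" "P ! pc = Add 2 2 s" "code_at P (Suc pc) (replicate k (Add 2 2 s))"
      by (auto simp: code_at_Cons)
    show ?case
      using Suc.IH[OF *(3), of "\<rho>(2 := \<rho> 2 + \<rho> s)"] \<open>s \<noteq> 2\<close> *(1,2)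
      by (intro reaches_step) (simp add: ram_step_eq fun_upd_def add.assoc cong: if_cong)
  qed
  have *: "b < length P" "P ! b = Const 2 j" "code_at P (Suc b) (replicate K (Add 2 2 s))"
    using assms by (auto simp: code_at_Cons)
  show ?thesis
    using adds[OF *(3), of "\<rho>(2 := j)"] \<open>s \<noteq> 2\<close> *(1,2)
    by (intro reaches_step) (simp add: ram_step_eq add.commute)
qed

text \<open>Quotient and remainder modulo \<open>K\<close> are unique, so different entries of the
  arrays below \<open>K\<close> occupy different cells.\<close>

lemma represents_Put:
  assumes "represents K \<rho> M s" "j < K"
  shows "represents K (\<rho>(2 := x)) (M(i * K + j := v)) (fst s, (snd s)(j := (snd s j)(i := v)))"
proof -
  have "i' * K + j' = i * K + j \<longleftrightarrow> i' = i \<and> j' = j" if "j' < K" for i' j'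
    using that assms(2) 
    by (metis (no_types, lifting) add.commute add_right_cancel div_mult_self1 div_less
        gr_implies_not0 mult_cancel_right plus_nat.add_0)
  then show ?thesis
    using assms by (auto simp: represents_def)
qed

lemma compile_correct:
  assumes "wf_com c" "arrays c \<subseteq> {..<K}" "code_at P b (compile K b c)" "represents K \<rho> M s"
  shows "\<exists>\<rho>' M'. represents K \<rho>' M' (run c s) \<and>
     reaches P ((K + 3) * cost c s) ((b, \<rho>), M) ((b + length (compile K b c), \<rho>'), M')"
  using assms
proof (induction c arbitrary: b \<rho> M s)
  case (SetC r k)
  let ?\<rho> = "\<rho>(r + 3 := k)"
  have "b < length P" "P ! b = Const (r + 3) k"
    using SetC.prems by (auto simp: code_at_Cons)
  then have "reaches P 1 ((b, \<rho>), M) ((Suc b, ?\<rho>), M)"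
    by (intro reaches_one) (simp add: ram_step_eq)
  then have "reaches P (K + 3) ((b, \<rho>), M) ((Suc b, ?\<rho>), M)"
    by (rule reaches_mono) simp
  moreover have "represents K ?\<rho> M (run (SetC r k) s)"
    using SetC.prems by (auto simp: represents_def)
  moreover have "b + length (compile K b (SetC r k)) = Suc b" "(K + 3) * cost (SetC r k) s = K + 3"
    by simp_all
  ultimately show ?case by metis
next
  case (AddC r x y)
  let ?\<rho> = "\<rho>(r + 3 := \<rho> (x + 3) + \<rho> (y + 3))"
  have "b < length P" "P ! b = Add (r + 3) (x + 3) (y + 3)"
    using AddC.prems by (auto simp: code_at_Cons)
  then have "reaches P 1 ((b, \<rho>), M) ((Suc b, ?\<rho>), M)"
    by (intro reaches_one) (simp add: ram_step_eq)
  then have "reaches P (K + 3) ((b, \<rho>), M) ((Suc b, ?\<rho>), M)"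
    by (rule reaches_mono) simp
  moreover have "represents K ?\<rho> M (run (AddC r x y) s)"
    using AddC.prems by (auto simp: represents_def)
  moreover have "b + length (compile K b (AddC r x y)) = Suc b" "(K + 3) * cost (AddC r x y) s = K + 3"
    by simp_all
  ultimately show ?case by metis
next
  case (SubC r x y)
  let ?\<rho> = "\<rho>(r + 3 := \<rho> (x + 3) - \<rho> (y + 3))"
  have "b < length P" "P ! b = Sub (r + 3) (x + 3) (y + 3)"
    using SubC.prems by (auto simp: code_at_Cons)
  then have "reaches P 1 ((b, \<rho>), M) ((Suc b, ?\<rho>), M)"
    by (intro reaches_one) (simp add: ram_step_eq)
  then have "reaches P (K + 3) ((b, \<rho>), M) ((Suc b, ?\<rho>), M)"
    by (rule reaches_mono) simp
  moreover have "represents K ?\<rho> M (run (SubC r x y) s)"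
    using SubC.prems by (auto simp: represents_def)
  moreover have "b + length (compile K b (SubC r x y)) = Suc b" "(K + 3) * cost (SubC r x y) s = K + 3"
    by simp_all
  ultimately show ?case by metis
next
  case (Get r j x)
  let ?addr = "\<rho> (x + 3) * K + j"
  let ?\<rho> = "\<rho>(2 := ?addr, r + 3 := M ?addr)"
  have at: "code_at P b (Const 2 j # replicate K (Add 2 2 (x + 3)))"
    and last: "b + Suc K < length P" "P ! (b + Suc K) = Load (r + 3) 2"
    using Get.prems(3) by (auto simp: code_at_Cons code_at_append)
  have "reaches P 1 ((b + Suc K, \<rho>(2 := ?addr)), M) ((b + Suc (Suc K), ?\<rho>), M)"
    using last by (intro reaches_one) (simp add: ram_step_eq)
  from reaches_trans[OF reaches_address[OF at] this]
  have "reaches P (K + 3) ((b, \<rho>), M) ((b + Suc (Suc K), ?\<rho>), M)"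
    by (auto elim: reaches_mono)
  moreover have "represents K ?\<rho> M (run (Get r j x) s)"
    using Get.prems by (auto simp: represents_def)
  moreover have "b + length (compile K b (Get r j x)) = b + Suc (Suc K)" "(K + 3) * cost (Get r j x) s = K + 3"
    by simp_all
  ultimately show ?case by metis
next
  case (Put j x y)
  let ?addr = "\<rho> (x + 3) * K + j"
  let ?\<rho> = "\<rho>(2 := ?addr)" and ?M = "M(?addr := \<rho> (y + 3))"
  have at: "code_at P b (Const 2 j # replicate K (Add 2 2 (x + 3)))"
    and last: "b + Suc K < length P" "P ! (b + Suc K) = Store 2 (y + 3)"
    using Put.prems(3) by (auto simp: code_at_Cons code_at_append)
  have "reaches P 1 ((b + Suc K, ?\<rho>), M) ((b + Suc (Suc K), ?\<rho>), ?M)"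
    using last by (intro reaches_one) (simp add: ram_step_eq)
  from reaches_trans[OF reaches_address[OF at] this]
  have "reaches P (K + 3) ((b, \<rho>), M) ((b + Suc (Suc K), ?\<rho>), ?M)"
    by (auto elim: reaches_mono)
  moreover have "represents K ?\<rho> ?M (run (Put j x y) s)"
    using represents_Put[OF Put.prems(4), of j] Put.prems by (auto simp: represents_def)
  moreover have "b + length (compile K b (Put j x y)) = b + Suc (Suc K)" "(K + 3) * cost (Put j x y) s = K + 3"
    by simp_all
  ultimately show ?case by metis
next
  case (Seq c d)
  let ?b = "b + length (compile K b c)"
  have at: "code_at P b (compile K b c)" "code_at P ?b (compile K ?b d)"
    using Seq.prems by (auto simp: code_at_append)
  obtain \<rho>' M' where 1: "represents K \<rho>' M' (run c s)"
    "reaches P ((K + 3) * cost c s) ((b, \<rho>), M) ((?b, \<rho>'), M')"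
    using Seq.IH(1)[OF _ _ at(1) Seq.prems(4)] Seq.prems by auto
  obtain \<rho>'' M'' where 2: "represents K \<rho>'' M'' (run d (run c s))"
    "reaches P ((K + 3) * cost d (run c s)) ((?b, \<rho>'), M') ((?b + length (compile K ?b d), \<rho>''), M'')"
    using Seq.IH(2)[OF _ _ at(2) 1(1)] Seq.prems by auto
  show ?case using reaches_trans[OF 1(2) 2(2)] 2(1)
    by - (rule exI[of _ \<rho>''], rule exI[of _ M''], auto simp: algebra_simps)
next
  case (For r c)
  let ?C = "compile K (b + 2) c"
  let ?e = "b + 3 + length ?C"
  have r: "r \<notin> assigned c" using For.prems by simp
  have len: "b + length (compile K b (For r c)) = ?e" by simp
  \<comment> \<open>The exit test is at \<open>b\<close>, the decrement at \<open>b + 1\<close>, the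
    body starts at \<open>b + 2\<close> and is followed by the jump back; \<open>?e\<close> is the
    first address behind it.\<close>
  have at: "b < length P" "P ! b = JumpZero (r + 3) ?e"
    "Suc b < length P" "P ! Suc b = Sub (r + 3) (r + 3) 1"
    "code_at P (b + 2) ?C"
    "b + 2 + length ?C < length P" "P ! (b + 2 + length ?C) = JumpZero 0 b"
    using For.prems(3) by (auto simp: code_at_Cons code_at_append)
  \<comment> \<open>An inner induction on the counter, for all states; the outer hypothesis covers
    the body.\<close>
  have "\<exists>\<rho>' M'. represents K \<rho>' M' (run (For r c) s) \<and>
     reaches P ((K + 3) * cost (For r c) s) ((b, \<rho>), M) ((?e, \<rho>'), M')"
    if "fst s r = n" "represents K \<rho> M s" for n
    using that
  proof (induction n arbitrary: s \<rho> M)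
    case 0
    then have "\<rho> (r + 3) = 0" by (simp add: represents_def)
    then have "reaches P 1 ((b, \<rho>), M) ((?e, \<rho>), M)"
      using at by (intro reaches_one) (simp add: ram_step_eq)
    with 0 show ?case
      by - (rule exI[of _ \<rho>], rule exI[of _ M], auto elim: reaches_mono)
  next
    case (Suc n)
    let ?\<rho> = "\<rho>(r + 3 := \<rho> (r + 3) - 1)"
    let ?s = "run c (dec r s)"
    have rep: "represents K ?\<rho> M (dec r s)"
      using Suc.prems by (auto simp: represents_def dec_def)
    obtain \<rho>' M' where 1: "represents K \<rho>' M' ?s"
      "reaches P ((K + 3) * cost c (dec r s)) ((b + 2, ?\<rho>), M) ((b + 2 + length ?C, \<rho>'), M')"
      using For.IH[OF _ _ at(5) rep] For.prems(1,2) unfolding wf_com.simps arrays.simps by blast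
    have "\<rho> (r + 3) \<noteq> 0" "\<rho> 1 = 1" using Suc.prems by (auto simp: represents_def)
    then have "reaches P 1 ((b, \<rho>), M) ((Suc b, \<rho>), M)"
      "reaches P 1 ((Suc b, \<rho>), M) ((b + 2, ?\<rho>), M)"
      using at by (intro reaches_one; simp add: ram_step_eq)+
    from reaches_trans[OF this] have 0: "reaches P 2 ((b, \<rho>), M) ((b + 2, ?\<rho>), M)"
      by (rule reaches_mono) simp
    have "\<rho>' 0 = 0" using 1 by (simp add: represents_def)
    then have 2: "reaches P 1 ((b + 2 + length ?C, \<rho>'), M') ((b, \<rho>'), M')"
      using at by (intro reaches_one) (simp add: ram_step_eq)
    have "fst ?s r = n" using Suc.prems r by (simp add: run_unassigned)
    from Suc.IH[OF this 1(1)] obtain \<rho>'' M'' where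
      3: "represents K \<rho>'' M'' (run (For r c) ?s)"
        "reaches P ((K + 3) * cost (For r c) ?s) ((b, \<rho>'), M') ((?e, \<rho>''), M'')"
      by blast
    have "reaches P (2 + (K + 3) * cost c (dec r s) + 1 + (K + 3) * cost (For r c) ?s)
            ((b, \<rho>), M) ((?e, \<rho>''), M'')"
      using reaches_trans[OF reaches_trans[OF reaches_trans[OF 0 1(2)] 2] 3(2)] .
    \<comment> \<open>Test, decrement and jump back are 3 steps, paid by the unit that
      \<open>cost\<close> charges for a round.\<close>
    moreover have "2 + (K + 3) * cost c (dec r s) + 1 + (K + 3) * cost (For r c) ?s
        \<le> (K + 3) * cost (For r c) s"
      unfolding For_Suc(2)[OF r Suc.prems(1)] add_mult_distrib2 by simp
    ultimately show ?case
      using 3(1) reaches_mono unfolding For_Suc(1)[OF r Suc.prems(1)] by blast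
  qed
  then show ?case unfolding len using For.prems by blast
qed

section \<open>Programs on words\<close>

lemma input_memory_snoc:
  "input_memory (w @ [v]) = (input_memory w)(Suc (length w) := v, 0 := Suc (length w))"
  by (auto simp: input_memory_def nth_append fun_eq_iff less_Suc_eq_le le_Suc_eq)

lemma input_memory_Nil: "input_memory [] = (\<lambda>_. 0)"
  by (auto simp: input_memory_def fun_eq_iff)

lemma output_memory_input_memory: "output_memory (input_memory w) w"
  by (auto simp: input_memory_def output_memory_def)

definition push :: "nat \<Rightarrow> nat \<Rightarrow> com" where
  "push j r = SetC 0 0 ;; SetC 1 1 ;; Get 2 j 0 ;; AddC 2 2 1 ;; Put j 2 r ;; Put j 0 2"

text \<open>Registers 0 to 2 are scratch, hence \<open>3 \<le> r\<close>. The result is again an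
  \<open>input_memory\<close>, blank behind the word, so pushes can be iterated and the array can
  become the input of a PRAM.\<close>

lemma push_run:
  assumes "snd s j = input_memory w" "3 \<le> r"
  shows "snd (run (push j r) s) = (snd s)(j := input_memory (w @ [fst s r]))"
  unfolding push_def using assms
  by (simp add: input_memory_snoc input_memory_def[of w 0])

lemma push_simps [simp]:
  "cost (push j r) s = 6" "assigned (push j r) = {0, 1, 2}"
  "arrays (push j r) = {j}" "updated (push j r) = {j}" "wf_com (push j r)"
  by (auto simp: push_def)

text \<open>Register 5 keeps the length, so that its difference to the falling counter runs upwards
  through the cells 1, 2, ... of the source.\<close>

definition append_word :: "nat \<Rightarrow> nat \<Rightarrow> com" where
  "append_word j u =
     SetC 0 0 ;; Get 4 u 0 ;; Get 5 u 0 ;; For 4 (SubC 6 5 4 ;; Get 3 u 6 ;; push j 3)"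

lemma append_word_simps [simp]:
  "arrays (append_word j u) = {j, u}" "updated (append_word j u) = {j}" "wf_com (append_word j u)"
  by (auto simp: append_word_def)

text \<open>Besides concatenation this serves to clean up: with \<open>w = []\<close> it turns an
  output, whose other cells are arbitrary, into a proper input memory.\<close>

lemma append_word_run:
  assumes "snd s j = input_memory w" "output_memory (snd s u) w'" "u \<noteq> j"
  shows "snd (run (append_word j u) s) = (snd s)(j := input_memory (w @ w'))"
    "cost (append_word j u) s \<le> 4 + 9 * length w'"
proof -
  let ?body = "SubC 6 5 4 ;; Get 3 u 6 ;; push j 3"
  define s1 where "s1 = run (SetC 0 0 ;; Get 4 u 0 ;; Get 5 u 0) s"
  define I where "I k t \<longleftrightarrow> snd t = (snd s)(j := input_memory (w @ take (length w' - k) w')) \<and>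
    fst t 5 = length w' \<and> k \<le> length w'" for k and t :: state
  have s1: "snd s1 = snd s" "fst s1 4 = length w'" "fst s1 5 = length w'"
    using assms by (auto simp: s1_def output_memory_def)
  have I0: "I (fst s1 4) s1"
    using s1 assms(1) by (auto simp: I_def)
  have step: "I k (run ?body (dec 4 t)) \<and> cost ?body (dec 4 t) \<le> 8"
    if I: "I (Suc k) t" and t: "fst t 4 = Suc k" for k t
  proof -
    let ?i = "length w' - Suc k"
    let ?t = "run (SubC 6 5 4 ;; Get 3 u 6) (dec 4 t)"
    have i: "?i < length w'" "length w' - k = Suc ?i" using I by (auto simp: I_def)
    then have "fst ?t 3 = w' ! ?i" "snd ?t = snd t"
      using I t assms(2,3) by (auto simp: I_def output_memory_def)
    moreover have "take (length w' - k) w' = take ?i w' @ [w' ! ?i]"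
      using i by (simp add: take_Suc_conv_app_nth)
    ultimately have "snd (run ?body (dec 4 t)) = (snd s)(j := input_memory (w @ take (length w' - k) w'))"
      using push_run[of ?t j "w @ take ?i w'" 3] I by (simp add: I_def)
    moreover have "fst (run ?body (dec 4 t)) 5 = length w'"
      using I run_unassigned[of 5 ?body "dec 4 t"] by (simp add: I_def)
    ultimately show ?thesis using I by (simp add: I_def)
  qed
  have "I 0 (run (For 4 ?body) s1)" "cost (For 4 ?body) s1 \<le> 1 + fst s1 4 * (1 + 8)"
    by (rule For_rule[of 4 ?body I, OF _ I0 step]; simp)+
  then show "snd (run (append_word j u) s) = (snd s)(j := input_memory (w @ w'))"
    "cost (append_word j u) s \<le> 4 + 9 * length w'"
    unfolding append_word_def s1_def using s1 by (auto simp: I_def s1_def)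
qed

text \<open>With truncated subtraction, \<open>(a - b) + (b - a)\<close> is the distance. Register 6
  adds up the distances of the lengths and of the symbols, so it ends at 0 exactly for equal words,
  and \<open>1 - r6\<close> is the length of the encoded truth value.\<close>

definition compare_words :: "nat \<Rightarrow> nat \<Rightarrow> nat \<Rightarrow> com" where
  "compare_words j u v =
     (SetC 0 0 ;; SetC 1 1 ;; Get 4 u 0 ;; Get 5 v 0 ;; SubC 6 4 5 ;; SubC 7 5 4 ;; AddC 6 6 7) ;;
     For 4 (AddC 5 4 1 ;; Get 2 u 5 ;; Get 3 v 5 ;;
            SubC 7 2 3 ;; AddC 6 6 7 ;; SubC 7 3 2 ;; AddC 6 6 7) ;;
     SubC 6 1 6 ;; Put j 0 6 ;; Put j 1 1"

lemma compare_words_simps [simp]: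
  "arrays (compare_words j u v) = {j, u, v}" "updated (compare_words j u v) = {j}"
  "wf_com (compare_words j u v)"
  by (auto simp: compare_words_def)

lemma compare_words_run:
  assumes "output_memory (snd s u) w" "output_memory (snd s v) w'"
  shows "output_memory (snd (run (compare_words j u v) s) j) (enc_bool (w = w'))"
    "cost (compare_words j u v) s \<le> 11 + 8 * length w"
proof -
  let ?body = "AddC 5 4 1 ;; Get 2 u 5 ;; Get 3 v 5 ;;
            SubC 7 2 3 ;; AddC 6 6 7 ;; SubC 7 3 2 ;; AddC 6 6 7"
  define s1 where "s1 = run (SetC 0 0 ;; SetC 1 1 ;; Get 4 u 0 ;; Get 5 v 0 ;;
    SubC 6 4 5 ;; SubC 7 5 4 ;; AddC 6 6 7) s"
  define I where "I k t \<longleftrightarrow> snd t = snd s \<and> fst t 0 = 0 \<and> fst t 1 = 1 \<and> k \<le> length w \<and>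
    (fst t 6 = 0 \<longleftrightarrow> length w = length w' \<and> (\<forall>i<length w. k \<le> i \<longrightarrow> w ! i = w' ! i))"
    for k and t :: state
  have s1: "snd s1 = snd s" "fst s1 4 = length w" "fst s1 0 = 0" "fst s1 1 = 1"
    "fst s1 6 = (length w - length w') + (length w' - length w)"
    using assms by (auto simp: s1_def output_memory_def)
  then have I0: "I (fst s1 4) s1" by (auto simp: I_def)
  have step: "I k (run ?body (dec 4 t)) \<and> cost ?body (dec 4 t) \<le> 7"
    if I: "I (Suc k) t" and t: "fst t 4 = Suc k" for k t
  proof -
    have u: "snd s u (Suc k) = w ! k"
      using I assms by (simp add: I_def output_memory_def)
    \<comment> \<open>For different lengths the cells behind the end of \<open>w'\<close> are
      unknown, but then register 6 is already positive and never decreases.\<close>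
    have v: "length w = length w' \<Longrightarrow> snd s v (Suc k) = w' ! k"
      using I assms by (simp add: I_def output_memory_def)
    have "(\<forall>i<length w. k \<le> i \<longrightarrow> w ! i = w' ! i) \<longleftrightarrow>
        w ! k = w' ! k \<and> (\<forall>i<length w. Suc k \<le> i \<longrightarrow> w ! i = w' ! i)"
      using I unfolding I_def by (metis Suc_le_eq order_le_less)
    then show ?thesis using I t u v by (auto simp: I_def)
  qed
  have *: "I 0 (run (For 4 ?body) s1)" "cost (For 4 ?body) s1 \<le> 1 + fst s1 4 * (1 + 7)"
    by (rule For_rule[of 4 ?body I, OF _ I0 step]; simp)+
  have "compare_words j u v = (SetC 0 0 ;; SetC 1 1 ;; Get 4 u 0 ;; Get 5 v 0 ;;
    SubC 6 4 5 ;; SubC 7 5 4 ;; AddC 6 6 7) ;; For 4 ?body ;; SubC 6 1 6 ;; Put j 0 6 ;; Put j 1 1"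
    by (simp add: compare_words_def)
  then have run: "run (compare_words j u v) s = run (SubC 6 1 6 ;; Put j 0 6 ;; Put j 1 1) (run (For 4 ?body) s1)"
    and cost: "cost (compare_words j u v) s = 7 + cost (For 4 ?body) s1 + 3"
    unfolding s1_def by simp_all
  have eq: "w = w' \<longleftrightarrow> fst (run (For 4 ?body) s1) 6 = 0"
    using *(1) by (auto simp: I_def list_eq_iff_nth_eq simp del: run.simps)
  show "output_memory (snd (run (compare_words j u v) s) j) (enc_bool (w = w'))"
    using *(1) unfolding run eq I_def
    by (auto simp: output_memory_def enc_bool_def simp del: run.simps(7))
  show "cost (compare_words j u v) s \<le> 11 + 8 * length w"
    using *(2) unfolding cost s1(2) by simp
qed

text \<open>The exponent is a constant, so its recursion is unrolled into the program; each factor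
  is a loop adding register \<open>y\<close> up \<open>x\<close> times, which keeps the cost linear
  in the base.\<close>

primrec power_com :: "nat \<Rightarrow> nat \<Rightarrow> nat \<Rightarrow> com" where
  "power_com x y 0 = SetC y 1"
| "power_com x y (Suc k) =
     power_com x y k ;; SetC 8 0 ;; AddC 9 x 0 ;; For 9 (AddC 8 8 y) ;; AddC y 8 0"

lemma power_com_simps [simp]:
  "arrays (power_com x y k) = {}" "updated (power_com x y k) = {}"
  "assigned (power_com x y k) \<subseteq> {y, 8, 9}" "wf_com (power_com x y k)"
  by (induction k) auto

lemma power_com_run:
  assumes "fst s 0 = 0" "x \<notin> {0, 8, 9}" "y \<notin> {0, 8, 9}" "x \<noteq> y"
  shows "fst (run (power_com x y k) s) y = fst s x ^ k \<and> snd (run (power_com x y k) s) = snd s \<and>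
    cost (power_com x y k) s \<le> 1 + k * (4 + 2 * fst s x)"
proof (induction k)
  case (Suc k)
  let ?body = "AddC 8 8 y"
  define s1 where "s1 = run (power_com x y k) s"
  have un: "fst s1 r = fst s r" if "r \<notin> {y, 8, 9}" for r
    unfolding s1_def using power_com_simps(3)[of x y k] that by (intro run_unassigned) blast
  define s2 where "s2 = run (SetC 8 0 ;; AddC 9 x 0) s1"
  have s2: "fst s2 8 = 0" "fst s2 9 = fst s x" "fst s2 y = fst s x ^ k" "fst s2 0 = 0" "snd s2 = snd s"
    unfolding s2_def using assms un[of x] un[of 0] Suc by (auto simp: s1_def)
  define I where "I n t \<longleftrightarrow> fst t 8 = (fst s x - n) * fst s x ^ k \<and> fst t y = fst s x ^ k \<and>
    n \<le> fst s x \<and> fst t 0 = 0 \<and> snd t = snd s" for n and t :: state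
  have I0: "I (fst s2 9) s2" using s2 by (auto simp: I_def)
  have step: "I n (run ?body (dec 9 t)) \<and> cost ?body (dec 9 t) \<le> 1"
    if I: "I (Suc n) t" and t: "fst t 9 = Suc n" for n t
  proof -
    have "fst s x - n = Suc (fst s x - Suc n)" using I by (auto simp: I_def)
    then show ?thesis using I t assms by (auto simp: I_def)
  qed
  have *: "I 0 (run (For 9 ?body) s2)" "cost (For 9 ?body) s2 \<le> 1 + fst s2 9 * (1 + 1)"
    by (rule For_rule[of 9 ?body I, OF _ I0 step]; simp)+
  have run: "run (power_com x y (Suc k)) s = run (AddC y 8 0) (run (For 9 ?body) s2)"
    and cost: "cost (power_com x y (Suc k)) s = cost (power_com x y k) s + 3 + cost (For 9 ?body) s2"
    unfolding s2_def s1_def by simp_all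
  show ?case
    unfolding run cost using * s2(2) Suc assms by (auto simp: I_def simp del: run.simps(7))
qed auto

section \<open>Simulation of a PRAM\<close>

lemma pram_step_halted:
  assumes "\<forall>i<p. proc_halted P (fst c i)"
  shows "pram_step P p c = c"
proof -
  have "mem_step P p c = snd c"
    using assms by (auto simp: mem_step_def writes_def fun_eq_iff)
  moreover have "(\<lambda>i. if i < p then proc_step P (snd c) (fst c i) else fst c i) = fst c"
    using assms by (auto simp: proc_step_def)
  ultimately show ?thesis by (simp add: pram_step_def)
qed

lemma pram_run_final:
  assumes "pram_run P p t M M'" "t \<le> T"
  shows "snd ((pram_step P p ^^ T) (init_config M)) = M'"
proof -
  obtain t' where t': "t' \<le> t" "\<forall>i<p. proc_halted P (fst ((pram_step P p ^^ t') (init_config M)) i)"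
    "snd ((pram_step P p ^^ t') (init_config M)) = M'"
    using assms(1) by (auto simp: pram_run_def Let_def)
  have "(pram_step P p ^^ (n + t')) (init_config M) = (pram_step P p ^^ t') (init_config M)" for n
    by (induction n) (simp_all add: pram_step_halted[OF t'(2)])
  from this[of "T - t'"] t' assms(2) show ?thesis by simp
qed

text \<open>
  Register 20 holds the index of the processor and register 21 its program counter. Array \<open>m\<close> is the
  shared memory, array \<open>b\<close> has the program counters, array \<open>b + 1\<close> a copy of them from before the
  current round, and array \<open>b + 2 + r\<close> the values of register \<open>r\<close>.
\<close>

definition proc_rep :: "nat \<Rightarrow> nat \<Rightarrow> (nat \<Rightarrow> memory) \<Rightarrow> nat \<Rightarrow> processor \<Rightarrow> bool" where
  "proc_rep b n A i q \<longleftrightarrow> A b i = fst q \<and> (\<forall>r<n. A (b + 2 + r) i = snd q r)"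

primrec instr_regs :: "instr \<Rightarrow> nat set" where
  "instr_regs (Const r k) = {r}"
| "instr_regs (Add r s t) = {r, s, t}"
| "instr_regs (Sub r s t) = {r, s, t}"
| "instr_regs (Load r s) = {r, s}"
| "instr_regs (Store r s) = {r, s}"
| "instr_regs (JumpZero r l) = {r}"

text \<open>Stores to the shared memory are left out here. The only conditional available is a
  bounded loop: a jump first writes the next address and then overwrites it in a loop with counter
  \<open>1 - R r\<close>, which has one round if the register is 0 and none otherwise.\<close>

primrec exec_code :: "nat \<Rightarrow> nat \<Rightarrow> instr \<Rightarrow> com" where
  "exec_code m b (Const r k) = SetC 26 k ;; Put (b + 2 + r) 20 26 ;; AddC 27 21 1 ;; Put b 20 27"
| "exec_code m b (Add r s t) =
     Get 26 (b + 2 + s) 20 ;; Get 27 (b + 2 + t) 20 ;; AddC 26 26 27 ;; Put (b + 2 + r) 20 26 ;;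
     AddC 27 21 1 ;; Put b 20 27"
| "exec_code m b (Sub r s t) =
     Get 26 (b + 2 + s) 20 ;; Get 27 (b + 2 + t) 20 ;; SubC 26 26 27 ;; Put (b + 2 + r) 20 26 ;;
     AddC 27 21 1 ;; Put b 20 27"
| "exec_code m b (Load r s) =
     Get 26 (b + 2 + s) 20 ;; Get 26 m 26 ;; Put (b + 2 + r) 20 26 ;; AddC 27 21 1 ;; Put b 20 27"
| "exec_code m b (Store r s) = AddC 27 21 1 ;; Put b 20 27"
| "exec_code m b (JumpZero r l) =
     AddC 27 21 1 ;; Put b 20 27 ;; Get 26 (b + 2 + r) 20 ;; SubC 26 1 26 ;; SetC 27 l ;;
     For 26 (Put b 20 27)"

text \<open>There is no skip command; setting the scratch register 26 takes its place.\<close>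

primrec store_code :: "nat \<Rightarrow> nat \<Rightarrow> instr \<Rightarrow> com" where
  "store_code m b (Const r k) = SetC 26 0"
| "store_code m b (Add r s t) = SetC 26 0"
| "store_code m b (Sub r s t) = SetC 26 0"
| "store_code m b (Load r s) = SetC 26 0"
| "store_code m b (Store r s) = Get 26 (b + 2 + r) 20 ;; Get 27 (b + 2 + s) 20 ;; Put m 26 27"
| "store_code m b (JumpZero r l) = SetC 26 0"

lemma exec_code_simps [simp]:
  "assigned (exec_code m b ins) \<subseteq> {26, 27}"
  "arrays (exec_code m b ins) \<subseteq> {m, b} \<union> (\<lambda>r. b + 2 + r) ` instr_regs ins"
  "updated (exec_code m b ins) \<subseteq> insert b ((\<lambda>r. b + 2 + r) ` instr_regs ins)"
  "wf_com (exec_code m b ins)"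
  by (cases ins; auto)+

lemma store_code_simps [simp]:
  "assigned (store_code m b ins) \<subseteq> {26, 27}"
  "arrays (store_code m b ins) \<subseteq> {m, b} \<union> (\<lambda>r. b + 2 + r) ` instr_regs ins"
  "updated (store_code m b ins) \<subseteq> {m}"
  "wf_com (store_code m b ins)"
  by (cases ins; auto)+

lemma funpow_Suc_0_minus: "(f ^^ (Suc 0 - x)) y = (if x = 0 then f y else y)"
  by (cases x) auto

lemma exec_code_run:
  assumes "fst s 1 = 1" "fst s 20 = i" "fst s 21 = fst q" "proc_rep b n (snd s) i q"
    and "instr_regs ins \<subseteq> {..<n}" "m < b"
  shows "proc_rep b n (snd (run (exec_code m b ins) s)) i (exec_instr (snd s m) ins q)"
    and "i' \<noteq> i \<Longrightarrow> snd (run (exec_code m b ins) s) j i' = snd s j i'"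
    and "cost (exec_code m b ins) s \<le> 8"
proof -
  obtain pc R where q: "q = (pc, R)" by (cases q)
  show "proc_rep b n (snd (run (exec_code m b ins) s)) i (exec_instr (snd s m) ins q)"
    using assms unfolding q by (cases ins) (auto simp: proc_rep_def)
  show "i' \<noteq> i \<Longrightarrow> snd (run (exec_code m b ins) s) j i' = snd s j i'"
    using assms by (cases ins) (auto simp: funpow_Suc_0_minus)
  show "cost (exec_code m b ins) s \<le> 8"
    using assms by (cases ins) (auto simp: funpow_Suc_0_minus)
qed

text \<open>The address of the instruction to run is in register 21.\<close>

primrec dispatch :: "(instr \<Rightarrow> com) \<Rightarrow> nat \<Rightarrow> program \<Rightarrow> com" where
  "dispatch f l [] = SetC 22 0"
| "dispatch f l (ins # P) =
     SetC 22 l ;; SubC 23 21 22 ;; SubC 24 22 21 ;; AddC 23 23 24 ;; SubC 25 1 23 ;;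
     For 25 (f ins) ;; dispatch f (Suc l) P"

lemma dispatch_assigned:
  "(\<And>ins. ins \<in> set P \<Longrightarrow> assigned (f ins) \<subseteq> {26, 27}) \<Longrightarrow> assigned (dispatch f l P) \<subseteq> {22..27}"
proof (induction P arbitrary: l)
  case (Cons ins P)
  then have "assigned (dispatch f (Suc l) P) \<subseteq> {22..27}" "assigned (f ins) \<subseteq> {26, 27}" by auto
  then show ?case by fastforce
qed auto

lemma dispatch_arrays: "arrays (dispatch f l P) = (\<Union>ins\<in>set P. arrays (f ins))"
  by (induction P arbitrary: l) auto

lemma dispatch_updated: "updated (dispatch f l P) = (\<Union>ins\<in>set P. updated (f ins))"
  by (induction P arbitrary: l) auto

lemma dispatch_wf:
  "(\<And>ins. ins \<in> set P \<Longrightarrow> assigned (f ins) \<subseteq> {26, 27} \<and> wf_com (f ins)) \<Longrightarrow> wf_com (dispatch f l P)"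
  by (induction P arbitrary: l) fastforce+

text \<open>Register 23 receives the distance of register 21 to the address, so the loop on
  \<open>1 - r23\<close> runs once on a match. Instruction code assigns only 26 and 27, hence at
  most one address matches. \<open>t\<close> is the state in which the selected code starts. An
  address costs 5 for the comparison and at most \<open>B + 2\<close> for the loop.\<close>

lemma dispatch_run:
  assumes "\<And>ins. ins \<in> set P \<Longrightarrow> assigned (f ins) \<subseteq> {26, 27}" "fst s 1 = 1"
    and "\<And>ins t. ins \<in> set P \<Longrightarrow> fst t 1 = 1 \<Longrightarrow> cost (f ins) t \<le> B"
  shows "(\<exists>t. (\<forall>r. r \<notin> {22..27} \<longrightarrow> fst t r = fst s r) \<and> snd t = snd s \<and>
     snd (run (dispatch f l P) s) =
       (if l \<le> fst s 21 \<and> fst s 21 < l + length P then snd (run (f (P ! (fst s 21 - l))) t) else snd s))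
     \<and> cost (dispatch f l P) s \<le> 1 + length P * (B + 7)"
  using assms
proof (induction P arbitrary: l s)
  case Nil
  then show ?case by auto
next
  case (Cons ins P)
  let ?test = "SetC 22 l ;; SubC 23 21 22 ;; SubC 24 22 21 ;; AddC 23 23 24 ;; SubC 25 1 23"
  define s1 where "s1 = run ?test s"
  define s2 where "s2 = run (For 25 (f ins)) s1"
  have as: "assigned (f ins) \<subseteq> {26, 27}" using Cons.prems(1) by simp
  have s1: "fst s1 25 = (if fst s 21 = l then 1 else 0)" "snd s1 = snd s"
    using Cons.prems(2) by (auto simp: s1_def)
  have s1r: "fst s1 r = fst s r" if "r \<notin> {22..27}" for r
    unfolding s1_def using that by (intro run_unassigned) auto
  have s2r: "fst s2 r = fst s r" if "r \<notin> {22..27}" for r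
  proof -
    have "fst s2 r = fst s1 r"
      unfolding s2_def using that as by (intro run_unassigned) auto
    with s1r[OF that] show ?thesis by simp
  qed
  have run: "run (dispatch f l (ins # P)) s = run (dispatch f (Suc l) P) s2"
    and cost: "cost (dispatch f l (ins # P)) s = 5 + cost (For 25 (f ins)) s1 + cost (dispatch f (Suc l) P) s2"
    unfolding s2_def s1_def by simp_all
  have "cost (f ins) (dec 25 s1) \<le> B"
    using Cons.prems(3)[of ins "dec 25 s1"] s1r[of 1] Cons.prems(2) by simp
  then have c1: "cost (For 25 (f ins)) s1 \<le> 2 + B"
    using s1 by auto
  obtain t where t: "\<forall>r. r \<notin> {22..27} \<longrightarrow> fst t r = fst s2 r" "snd t = snd s2"
    "snd (run (dispatch f (Suc l) P) s2) =
      (if Suc l \<le> fst s2 21 \<and> fst s2 21 < Suc l + length P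
       then snd (run (f (P ! (fst s2 21 - Suc l))) t) else snd s2)"
    and c2: "cost (dispatch f (Suc l) P) s2 \<le> 1 + length P * (B + 7)"
    using Cons.IH[of s2 "Suc l"] Cons.prems s2r[of 1] by auto
  have c: "cost (dispatch f l (ins # P)) s \<le> 1 + length (ins # P) * (B + 7)"
    unfolding cost using c1 c2 by simp
  show ?case
  proof (cases "fst s 21 = l")
    case True
    then have "snd s2 = snd (run (f ins) (dec 25 s1))"
      using s1 by (simp add: s2_def)
    \<comment> \<open>The remaining addresses are all larger than register 21, so the rest of the
      dispatch changes no array.\<close>
    then have "snd (run (dispatch f l (ins # P)) s) = snd (run (f ins) (dec 25 s1))"
      unfolding run t(3) using True s2r[of 21] by simp
    moreover have "\<forall>r. r \<notin> {22..27} \<longrightarrow> fst (dec 25 s1) r = fst s r"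
      using s1r by (auto simp: dec_def)
    ultimately show ?thesis using True c s1(2)
      by (intro conjI exI[of _ "dec 25 s1"]) auto
  next
    case False
    then have s2: "snd s2 = snd s" using s1 by (simp add: s2_def)
    have "(Suc l \<le> fst s2 21 \<and> fst s2 21 < Suc l + length P) =
      (l \<le> fst s 21 \<and> fst s 21 < l + length (ins # P))"
      using False s2r[of 21] by auto
    moreover have "P ! (fst s2 21 - Suc l) = (ins # P) ! (fst s 21 - l)"
      if "l \<le> fst s 21"
    proof -
      have "fst s 21 - l = Suc (fst s2 21 - Suc l)" using that False s2r[of 21] by auto
      then show ?thesis by simp
    qed
    ultimately have "snd (run (dispatch f l (ins # P)) s) =
      (if l \<le> fst s 21 \<and> fst s 21 < l + length (ins # P)
       then snd (run (f ((ins # P) ! (fst s 21 - l))) t) else snd s)"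
      unfolding run t(3) using s2 by auto
    then show ?thesis using c t(1,2) s2r s2
      by (intro conjI exI[of _ t]) auto
  qed
qed

text \<open>All reads of a round must see the memory from before it, so every processor is visited
  twice: for everything except stores, then for the stores. The old program counter is kept because
  the second visit has to find the same instruction.\<close>

definition pass1 :: "nat \<Rightarrow> nat \<Rightarrow> program \<Rightarrow> com" where
  "pass1 m b P = (Get 21 b 20 ;; Put (b + 1) 20 21) ;; dispatch (exec_code m b) 0 P"

definition pass2 :: "nat \<Rightarrow> nat \<Rightarrow> program \<Rightarrow> com" where
  "pass2 m b P = Get 21 (b + 1) 20 ;; dispatch (store_code m b) 0 P"

definition prog_regs :: "program \<Rightarrow> nat set" where
  "prog_regs P = (\<Union>ins\<in>set P. instr_regs ins)"

lemma finite_prog_regs: "finite (prog_regs P)"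
proof -
  have "finite (instr_regs ins)" for ins by (cases ins) auto
  then show ?thesis by (simp add: prog_regs_def)
qed

lemma pass1_simps [simp]:
  "assigned (pass1 m b P) \<subseteq> {21..27}"
  "arrays (pass1 m b P) \<subseteq> {m, b, b + 1} \<union> (\<lambda>r. b + 2 + r) ` prog_regs P"
  "updated (pass1 m b P) \<subseteq> {b, b + 1} \<union> (\<lambda>r. b + 2 + r) ` prog_regs P"
  "wf_com (pass1 m b P)"
proof -
  have "assigned (dispatch (exec_code m b) 0 P) \<subseteq> {22..27}"
    by (rule dispatch_assigned) simp
  then show "assigned (pass1 m b P) \<subseteq> {21..27}" by (auto simp: pass1_def)
  have "arrays (exec_code m b ins) \<subseteq> {m, b} \<union> (\<lambda>r. b + 2 + r) ` prog_regs P"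
    "updated (exec_code m b ins) \<subseteq> insert b ((\<lambda>r. b + 2 + r) ` prog_regs P)" if "ins \<in> set P" for ins
    using exec_code_simps(2,3)[of m b ins] that unfolding prog_regs_def by blast+
  then have "(\<Union>ins\<in>set P. arrays (exec_code m b ins)) \<subseteq> {m, b} \<union> (\<lambda>r. b + 2 + r) ` prog_regs P"
    "(\<Union>ins\<in>set P. updated (exec_code m b ins)) \<subseteq> insert b ((\<lambda>r. b + 2 + r) ` prog_regs P)"
    by (blast intro!: UN_least)+
  then show "arrays (pass1 m b P) \<subseteq> {m, b, b + 1} \<union> (\<lambda>r. b + 2 + r) ` prog_regs P"
    "updated (pass1 m b P) \<subseteq> {b, b + 1} \<union> (\<lambda>r. b + 2 + r) ` prog_regs P"
    by (simp add: pass1_def dispatch_arrays dispatch_updated; blast)+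
  have "wf_com (dispatch (exec_code m b) 0 P)" by (rule dispatch_wf) simp
  then show "wf_com (pass1 m b P)" by (simp add: pass1_def)
qed

lemma pass2_simps [simp]:
  "assigned (pass2 m b P) \<subseteq> {21..27}"
  "arrays (pass2 m b P) \<subseteq> {m, b, b + 1} \<union> (\<lambda>r. b + 2 + r) ` prog_regs P"
  "updated (pass2 m b P) \<subseteq> {m}"
  "wf_com (pass2 m b P)"
proof -
  have "assigned (dispatch (store_code m b) 0 P) \<subseteq> {22..27}"
    by (rule dispatch_assigned) simp
  then show "assigned (pass2 m b P) \<subseteq> {21..27}" by (auto simp: pass2_def)
  have "arrays (store_code m b ins) \<subseteq> {m, b} \<union> (\<lambda>r. b + 2 + r) ` prog_regs P"
    "updated (store_code m b ins) \<subseteq> {m}" if "ins \<in> set P" for ins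
    using store_code_simps(2,3)[of m b ins] that unfolding prog_regs_def by blast+
  then have "(\<Union>ins\<in>set P. arrays (store_code m b ins)) \<subseteq> {m, b} \<union> (\<lambda>r. b + 2 + r) ` prog_regs P"
    "(\<Union>ins\<in>set P. updated (store_code m b ins)) \<subseteq> {m}"
    by (blast intro!: UN_least)+
  then show "arrays (pass2 m b P) \<subseteq> {m, b, b + 1} \<union> (\<lambda>r. b + 2 + r) ` prog_regs P"
    "updated (pass2 m b P) \<subseteq> {m}"
    by (simp add: pass2_def dispatch_arrays dispatch_updated; blast)+
  have "wf_com (dispatch (store_code m b) 0 P)" by (rule dispatch_wf) simp
  then show "wf_com (pass2 m b P)" by (simp add: pass2_def)
qed

lemma pass1_run:
  assumes "fst s 1 = 1" "fst s 20 = i" "proc_rep b n (snd s) i q" "prog_regs P \<subseteq> {..<n}" "m < b"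
  shows "proc_rep b n (snd (run (pass1 m b P) s)) i (proc_step P (snd s m) q)"
    "snd (run (pass1 m b P) s) (b + 1) i = fst q"
    "i' \<noteq> i \<Longrightarrow> snd (run (pass1 m b P) s) j i' = snd s j i'"
    "cost (pass1 m b P) s \<le> 3 + 15 * length P"
proof -
  let ?f = "exec_code m b"
  define s1 where "s1 = run (Get 21 b 20 ;; Put (b + 1) 20 21) s"
  have s1: "fst s1 1 = 1" "fst s1 20 = i" "fst s1 21 = fst q"
    "snd s1 = (snd s)(b + 1 := (snd s (b + 1))(i := fst q))"
    using assms(1-3) by (auto simp: s1_def proc_rep_def)
  have run: "run (pass1 m b P) s = run (dispatch ?f 0 P) s1"
    and cost: "cost (pass1 m b P) s = 2 + cost (dispatch ?f 0 P) s1"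
    by (simp_all add: pass1_def s1_def)
  have rep: "proc_rep b n (snd s1) i q"
    using assms(3) by (auto simp: s1 proc_rep_def)
  have cost_le: "cost (?f ins) t \<le> 8" if "fst t 1 = 1" for ins t
    using that by (cases ins) (auto simp: funpow_Suc_0_minus)
  obtain t where t: "\<forall>r. r \<notin> {22..27} \<longrightarrow> fst t r = fst s1 r" "snd t = snd s1"
    "snd (run (dispatch ?f 0 P) s1) = (if fst q < length P then snd (run (?f (P ! fst q)) t) else snd s1)"
    and c: "cost (dispatch ?f 0 P) s1 \<le> 1 + length P * 15"
    using dispatch_run[of P ?f s1 8 0] cost_le s1 by auto
  have t': "fst t 1 = 1" "fst t 20 = i" "fst t 21 = fst q" "proc_rep b n (snd t) i q"
    using t s1 rep by auto
  have sub: "instr_regs (P ! fst q) \<subseteq> {..<n}" if "fst q < length P"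
    using assms(4) nth_mem[OF that] unfolding prog_regs_def by blast
  have m: "snd t m = snd s m" using t(2) s1(4) assms(5) by simp
  show "cost (pass1 m b P) s \<le> 3 + 15 * length P" unfolding cost using c by simp
  show "proc_rep b n (snd (run (pass1 m b P) s)) i (proc_step P (snd s m) q)"
  proof (cases "fst q < length P")
    case True
    with exec_code_run(1)[OF t' sub assms(5)] show ?thesis
      by (simp add: run t(3) m proc_step_def proc_halted_def)
  next
    case False
    then show ?thesis using rep by (simp add: run t(3) proc_step_def proc_halted_def)
  qed
  show "snd (run (pass1 m b P) s) (b + 1) i = fst q"
  proof (cases "fst q < length P")
    case True
    have "b + 1 \<notin> updated (?f (P ! fst q))"
      using exec_code_simps(3)[of m b "P ! fst q"] by auto
    then show ?thesis using True s1(4) by (simp add: run t run_not_updated)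
  next
    case False
    then show ?thesis by (simp add: run t(3) s1(4))
  qed
  show "snd (run (pass1 m b P) s) j i' = snd s j i'" if "i' \<noteq> i"
    using that exec_code_run(2)[OF t' sub assms(5) that]
    by (cases "fst q < length P") (simp_all add: run t(2,3) s1(4))
qed

text \<open>At this point the arrays already describe the processor after its step. A
  \<open>Store\<close> changes no register, so old and new values agree for the registers it names,
  and only for these are they assumed to be the old ones.\<close>

lemma pass2_run:
  assumes "fst s 1 = 1" "fst s 20 = i" "snd s (b + 1) i = fst q"
    and "\<And>r t. \<not> proc_halted P q \<Longrightarrow> P ! fst q = Store r t \<Longrightarrow>
      snd s (b + 2 + r) i = snd q r \<and> snd s (b + 2 + t) i = snd q t"
  shows "snd (run (pass2 m b P) s) = (snd s)(m := store_effect P q (snd s m))"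
    "cost (pass2 m b P) s \<le> 2 + 10 * length P"
proof -
  let ?f = "store_code m b"
  define s1 where "s1 = run (Get 21 (b + 1) 20) s"
  have s1: "fst s1 1 = 1" "fst s1 20 = i" "fst s1 21 = fst q" "snd s1 = snd s"
    using assms(1-3) by (auto simp: s1_def)
  have run: "run (pass2 m b P) s = run (dispatch ?f 0 P) s1"
    and cost: "cost (pass2 m b P) s = 1 + cost (dispatch ?f 0 P) s1"
    by (simp_all add: pass2_def s1_def)
  have cost_le: "cost (?f ins) t \<le> 3" for ins t
    by (cases ins) auto
  obtain t where t: "\<forall>r. r \<notin> {22..27} \<longrightarrow> fst t r = fst s1 r" "snd t = snd s1"
    "snd (run (dispatch ?f 0 P) s1) = (if fst q < length P then snd (run (?f (P ! fst q)) t) else snd s1)"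
    and c: "cost (dispatch ?f 0 P) s1 \<le> 1 + length P * 10"
    using dispatch_run[of P ?f s1 3 0] cost_le s1 by auto
  show "cost (pass2 m b P) s \<le> 2 + 10 * length P" unfolding cost using c by simp
  have "fst t 20 = i" using t(1) s1 by simp
  then show "snd (run (pass2 m b P) s) = (snd s)(m := store_effect P q (snd s m))"
    using assms(4) t(2) s1(4)
    by (cases "P ! fst q") (auto simp: run t(3) store_effect_def proc_halted_def)
qed

section \<open>One round of all processors, then the whole run\<close>

definition config_rep :: "nat \<Rightarrow> nat \<Rightarrow> nat \<Rightarrow> nat \<Rightarrow> (nat \<Rightarrow> memory) \<Rightarrow> config \<Rightarrow> bool" where
  "config_rep m b n p A c \<longleftrightarrow> A m = snd c \<and> (\<forall>i<p. proc_rep b n A i (fst c i))"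

definition simulate_step :: "nat \<Rightarrow> nat \<Rightarrow> program \<Rightarrow> com" where
  "simulate_step m b P =
     AddC 20 11 0 ;; For 20 (pass1 m b P) ;; AddC 20 11 0 ;; For 20 (pass2 m b P)"

lemma simulate_step_simps [simp]:
  "assigned (simulate_step m b P) \<subseteq> {20..27}"
  "arrays (simulate_step m b P) \<subseteq> {m, b, b + 1} \<union> (\<lambda>r. b + 2 + r) ` prog_regs P"
  "updated (simulate_step m b P) \<subseteq> {m, b, b + 1} \<union> (\<lambda>r. b + 2 + r) ` prog_regs P"
  "wf_com (simulate_step m b P)"
proof -
  show "assigned (simulate_step m b P) \<subseteq> {20..27}"
    using pass1_simps(1)[of m b P] pass2_simps(1)[of m b P] by (fastforce simp: simulate_step_def)
  show "arrays (simulate_step m b P) \<subseteq> {m, b, b + 1} \<union> (\<lambda>r. b + 2 + r) ` prog_regs P"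
    using pass1_simps(2)[of m b P] pass2_simps(2)[of m b P] by (simp add: simulate_step_def)
  show "updated (simulate_step m b P) \<subseteq> {m, b, b + 1} \<union> (\<lambda>r. b + 2 + r) ` prog_regs P"
    using pass1_simps(3)[of m b P] pass2_simps(3)[of m b P]
    unfolding simulate_step_def updated.simps by blast
  have "20 \<notin> assigned (pass1 m b P)" "20 \<notin> assigned (pass2 m b P)"
    using pass1_simps(1)[of m b P] pass2_simps(1)[of m b P] by fastforce+
  then show "wf_com (simulate_step m b P)" by (simp add: simulate_step_def)
qed

lemma simulate_step_run:
  assumes "fst s 0 = 0" "fst s 1 = 1" "fst s 11 = p"
    and "config_rep m b n p (snd s) c" "prog_regs P \<subseteq> {..<n}" "m < b"
  shows "config_rep m b n p (snd (run (simulate_step m b P) s)) (pram_step P p c)"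
    "cost (simulate_step m b P) s \<le> 4 + p * (7 + 25 * length P)"
proof -
  let ?p1 = "pass1 m b P" and ?p2 = "pass2 m b P"
  have as1: "r \<notin> assigned ?p1" and as2: "r \<notin> assigned ?p2" if "r \<notin> {21..27}" for r
    using that pass1_simps(1)[of m b P] pass2_simps(1)[of m b P] by blast+
  define s1 where "s1 = run (AddC 20 11 0) s"
  have s1: "fst s1 0 = 0" "fst s1 1 = 1" "fst s1 11 = p" "fst s1 20 = p" "snd s1 = snd s"
    using assms by (auto simp: s1_def)
  \<comment> \<open>Processors from \<open>k\<close> on have made their step and left the old
    program counter in array \<open>b + 1\<close>; those below \<open>k\<close> and the shared
    memory are as before.\<close>
  define I where "I k t \<longleftrightarrow> fst t 0 = 0 \<and> fst t 1 = 1 \<and> fst t 11 = p \<and> k \<le> p \<and> snd t m = snd c \<and>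
    (\<forall>i<p. if k \<le> i then proc_rep b n (snd t) i (proc_step P (snd c) (fst c i)) \<and>
        snd t (b + 1) i = fst (fst c i)
      else proc_rep b n (snd t) i (fst c i))" for k and t :: state
  have I0: "I (fst s1 20) s1"
    using assms s1 by (auto simp: I_def config_rep_def)
  have step: "I k (run ?p1 (dec 20 t)) \<and> cost ?p1 (dec 20 t) \<le> 3 + 15 * length P"
    if I: "I (Suc k) t" and k: "fst t 20 = Suc k" for k t
  proof -
    let ?t = "dec 20 t"
    have *: "fst ?t 1 = 1" "fst ?t 20 = k" "proc_rep b n (snd ?t) k (fst c k)"
      using I k by (auto simp: I_def)
    note p1 = pass1_run[OF * assms(5,6)]
    have "m \<notin> updated ?p1" using pass1_simps(3)[of m b P] assms(6) by auto
    then have m: "snd (run ?p1 ?t) m = snd c" "snd ?t m = snd c" using I by (simp_all add: run_not_updated I_def)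
    have other: "proc_rep b n (snd (run ?p1 ?t)) i q = proc_rep b n (snd t) i q"
      "snd (run ?p1 ?t) (b + 1) i = snd t (b + 1) i" if "i \<noteq> k" for i q
      using p1(3)[OF that] by (simp_all add: proc_rep_def)
    have "fst (run ?p1 ?t) 0 = 0 \<and> fst (run ?p1 ?t) 1 = 1 \<and> fst (run ?p1 ?t) 11 = p"
      using I by (simp add: run_unassigned[OF as1] I_def)
    moreover have "if k \<le> i then proc_rep b n (snd (run ?p1 ?t)) i (proc_step P (snd c) (fst c i)) \<and>
        snd (run ?p1 ?t) (b + 1) i = fst (fst c i)
      else proc_rep b n (snd (run ?p1 ?t)) i (fst c i)" if "i < p" for i
    proof (cases "i = k")
      case True
      then show ?thesis using p1(1,2) m by simp
    next
      case False
      then have "k \<le> i \<longleftrightarrow> Suc k \<le> i" by auto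
      moreover have "if Suc k \<le> i then proc_rep b n (snd t) i (proc_step P (snd c) (fst c i)) \<and>
          snd t (b + 1) i = fst (fst c i)
        else proc_rep b n (snd t) i (fst c i)"
        using I \<open>i < p\<close> unfolding I_def by blast
      ultimately show ?thesis unfolding other[OF False] by presburger
    qed
    ultimately show ?thesis using I m(1) p1(4) Suc_leD unfolding I_def by blast
  qed
  have 1: "I 0 (run (For 20 ?p1) s1)" "cost (For 20 ?p1) s1 \<le> 1 + fst s1 20 * (1 + (3 + 15 * length P))"
    by (rule For_rule[of 20 ?p1 I, OF _ I0 step]; use as1 in simp)+
  define s2 where "s2 = run (AddC 20 11 0) (run (For 20 ?p1) s1)"
  have s2: "fst s2 0 = 0" "fst s2 1 = 1" "fst s2 20 = p" "snd s2 m = snd c"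
    and s2p: "\<And>i. i < p \<Longrightarrow> proc_rep b n (snd s2) i (proc_step P (snd c) (fst c i))"
      "\<And>i. i < p \<Longrightarrow> snd s2 (b + 1) i = fst (fst c i)"
    using 1(1) by (auto simp: s2_def I_def simp del: run.simps(7))
  \<comment> \<open>\<open>mem_step P k\<close> stands for the stores still to come. Carrying out
    that of the highest remaining processor lowers the index by \<open>mem_step_Suc\<close>, and at
    0 nothing is left.\<close>
  define J where "J k t \<longleftrightarrow> fst t 1 = 1 \<and> k \<le> p \<and> (\<forall>j. j \<noteq> m \<longrightarrow> snd t j = snd s2 j) \<and>
    mem_step P k (fst c, snd t m) = mem_step P p c" for k and t :: state
  have J0: "J (fst s2 20) s2" using s2 by (auto simp: J_def)
  have step2: "J k (run ?p2 (dec 20 t)) \<and> cost ?p2 (dec 20 t) \<le> 2 + 10 * length P"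
    if J: "J (Suc k) t" and k: "fst t 20 = Suc k" for k t
  proof -
    let ?t = "dec 20 t"
    have kp: "k < p" using J by (simp add: J_def)
    have t: "snd ?t (b + r) = snd s2 (b + r)" for r
      using J assms(6) by (simp add: J_def)
    have regs: "snd ?t (b + 2 + r) k = snd (fst c k) r \<and> snd ?t (b + 2 + r') k = snd (fst c k) r'"
      if "\<not> proc_halted P (fst c k)" "P ! fst (fst c k) = Store r r'" for r r'
    proof -
      have "P ! fst (fst c k) \<in> set P"
        using that by (intro nth_mem) (simp add: proc_halted_def)
      then have "instr_regs (Store r r') \<subseteq> prog_regs P"
        unfolding that(2) prog_regs_def by (rule UN_upper)
      then have "r < n" "r' < n"
        using assms(5) by auto
      moreover have "snd (proc_step P (snd c) (fst c k)) = snd (fst c k)"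
        using that by (cases "fst c k") (simp add: proc_step_def)
      ultimately show ?thesis
        using s2p(1)[OF kp] t[of "2 + r"] t[of "2 + r'"] by (simp add: proc_rep_def add.assoc)
    qed
    have *: "fst ?t 1 = 1" "fst ?t 20 = k" "snd ?t (b + 1) k = fst (fst c k)"
      using J k t[of 1] s2p(2)[OF kp] by (auto simp: J_def)
    note p2 = pass2_run[where m = m, OF * regs]
    have "mem_step P k (fst c, store_effect P (fst c k) (snd t m)) = mem_step P p c"
      using J by (simp add: J_def mem_step_Suc)
    then show ?thesis using J p2(2) kp
      by (simp add: J_def p2(1) run_unassigned[OF as2])
  qed
  have 2: "J 0 (run (For 20 ?p2) s2)" "cost (For 20 ?p2) s2 \<le> 1 + fst s2 20 * (1 + (2 + 10 * length P))"
    by (rule For_rule[of 20 ?p2 J, OF _ J0 step2]; use as2 in simp)+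
  have run: "run (simulate_step m b P) s = run (For 20 ?p2) s2"
    and cost: "cost (simulate_step m b P) s = 2 + cost (For 20 ?p1) s1 + cost (For 20 ?p2) s2"
    unfolding simulate_step_def s2_def s1_def by simp_all
  show "cost (simulate_step m b P) s \<le> 4 + p * (7 + 25 * length P)"
    unfolding cost using 1(2) 2(2) unfolding s1(4) s2(3) by (simp add: algebra_simps)
  have "proc_rep b n (snd (run (For 20 ?p2) s2)) i q = proc_rep b n (snd s2) i q" for i q
    using 2(1) assms(6) by (simp add: proc_rep_def J_def)
  then show "config_rep m b n p (snd (run (simulate_step m b P) s)) (pram_step P p c)"
    using 2(1) s2p(1) unfolding run
    by (simp add: config_rep_def pram_step_def J_def mem_step_0)
qed

text \<open>Register 10 gets \<open>n + 2\<close> for input length \<open>n\<close>, register 11 the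
  number of processors and register 12 the number of rounds. Initially only register 0 of a
  processor is nonzero, so on blank arrays it is enough to write the indices into array
  \<open>b + 2\<close>.\<close>

definition simulate :: "nat \<Rightarrow> nat \<Rightarrow> program \<Rightarrow> nat \<Rightarrow> nat \<Rightarrow> com" where
  "simulate m b P k e =
     (SetC 0 0 ;; SetC 1 1 ;; Get 10 m 0 ;; AddC 10 10 1 ;; AddC 10 10 1) ;;
     power_com 10 11 k ;; power_com 10 12 e ;;
     AddC 20 11 0 ;; For 20 (Put (b + 2) 20 20) ;; For 12 (simulate_step m b P)"

lemma simulate_simps [simp]:
  "arrays (simulate m b P k e) \<subseteq> {m, b, b + 1, b + 2} \<union> (\<lambda>r. b + 2 + r) ` prog_regs P"
  "updated (simulate m b P k e) \<subseteq> {m, b, b + 1, b + 2} \<union> (\<lambda>r. b + 2 + r) ` prog_regs P"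
  "wf_com (simulate m b P k e)"
proof -
  show "arrays (simulate m b P k e) \<subseteq> {m, b, b + 1, b + 2} \<union> (\<lambda>r. b + 2 + r) ` prog_regs P"
    using simulate_step_simps(2)[of m b P] by (auto simp: simulate_def)
  show "updated (simulate m b P k e) \<subseteq> {m, b, b + 1, b + 2} \<union> (\<lambda>r. b + 2 + r) ` prog_regs P"
    using simulate_step_simps(3)[of m b P] by (auto simp: simulate_def)
  have "12 \<notin> assigned (simulate_step m b P)"
    using simulate_step_simps(1)[of m b P] by fastforce
  then show "wf_com (simulate m b P k e)" by (simp add: simulate_def)
qed

lemma simulate_run:
  assumes "snd s m = input_memory w" "\<And>j. b \<le> j \<Longrightarrow> snd s j = (\<lambda>_. 0)" "m < b"
  shows "snd (run (simulate m b P k e) s) m =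
      snd ((pram_step P ((length w + 2) ^ k) ^^ ((length w + 2) ^ e)) (init_config (input_memory w)))"
    "cost (simulate m b P k e) s \<le> 10 + (k + e) * (8 + 2 * length w) + 2 * (length w + 2) ^ k +
       (length w + 2) ^ e * (5 + (length w + 2) ^ k * (7 + 25 * length P))"
proof -
  define x where "x = length w + 2"
  define p T where "p = x ^ k" and "T = x ^ e"
  \<comment> \<open>The program names finitely many registers, so finitely many arrays suffice to
    follow a processor.\<close>
  obtain n where n: "prog_regs P \<subseteq> {..<n}"
    using finite_prog_regs[of P] finite_nat_set_iff_bounded by (metis lessThan_iff subsetI)
  define s1 where "s1 = run (SetC 0 0 ;; SetC 1 1 ;; Get 10 m 0 ;; AddC 10 10 1 ;; AddC 10 10 1) s"
  have s1: "fst s1 0 = 0" "fst s1 1 = 1" "fst s1 10 = x" "snd s1 = snd s"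
    using assms(1) by (auto simp: s1_def x_def input_memory_def)
  define s2 where "s2 = run (power_com 10 11 k) s1"
  have "fst s2 r = fst s1 r" if "r \<notin> {11, 8, 9}" for r
    using that power_com_simps(3)[of 10 11 k] unfolding s2_def by (intro run_unassigned) blast
  with power_com_run[of s1 10 11 k] s1
  have s2: "fst s2 0 = 0" "fst s2 1 = 1" "fst s2 10 = x" "fst s2 11 = p" "snd s2 = snd s"
    and c1: "cost (power_com 10 11 k) s1 \<le> 1 + k * (4 + 2 * x)"
    by (auto simp: p_def s2_def)
  define s3 where "s3 = run (power_com 10 12 e) s2"
  have "fst s3 r = fst s2 r" if "r \<notin> {12, 8, 9}" for r
    using that power_com_simps(3)[of 10 12 e] unfolding s3_def by (intro run_unassigned) blast
  with power_com_run[of s2 10 12 e] s2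
  have s3: "fst s3 0 = 0" "fst s3 1 = 1" "fst s3 11 = p" "fst s3 12 = T" "snd s3 = snd s"
    and c2: "cost (power_com 10 12 e) s2 \<le> 1 + e * (4 + 2 * x)"
    by (auto simp: T_def s3_def)
  define s4 where "s4 = run (AddC 20 11 0) s3"
  have s4: "fst s4 0 = 0" "fst s4 1 = 1" "fst s4 11 = p" "fst s4 12 = T" "fst s4 20 = p" "snd s4 = snd s"
    using s3 by (auto simp: s4_def)
  let ?ini = "Put (b + 2) 20 20"
  define I where "I i t \<longleftrightarrow> (\<forall>r. r \<noteq> 20 \<longrightarrow> fst t r = fst s4 r) \<and> (\<forall>j. j \<noteq> b + 2 \<longrightarrow> snd t j = snd s j)
    \<and> (\<forall>i'. i \<le> i' \<longrightarrow> i' < p \<longrightarrow> snd t (b + 2) i' = i')" for i and t :: state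
  have I0: "I (fst s4 20) s4" using s4 by (auto simp: I_def)
  have step: "I i (run ?ini (dec 20 t)) \<and> cost ?ini (dec 20 t) \<le> 1"
    if I: "I (Suc i) t" and k: "fst t 20 = Suc i" for i t
    using I k by (auto simp: I_def)
  have 1: "I 0 (run (For 20 ?ini) s4)" "cost (For 20 ?ini) s4 \<le> 1 + fst s4 20 * (1 + 1)"
    by (rule For_rule[of 20 ?ini I, OF _ I0 step]; simp)+
  define s5 where "s5 = run (For 20 ?ini) s4"
  have s5: "fst s5 0 = 0" "fst s5 1 = 1" "fst s5 11 = p" "fst s5 12 = T"
    and s5A: "\<And>j. j \<noteq> b + 2 \<Longrightarrow> snd s5 j = snd s j" "\<And>i. i < p \<Longrightarrow> snd s5 (b + 2) i = i"
    using 1(1) s4 by (auto simp: s5_def I_def simp del: run.simps)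
  have m: "snd s5 m = input_memory w" using s5A(1)[of m] assms by simp
  let ?c = "init_config (input_memory w)"
  have reg: "snd s5 (b + 2 + r) i = (if r = 0 then i else 0)" if "i < p" for r i
    using s5A(1)[of "b + 2 + r"] s5A(2)[OF that] assms(2)[of "b + 2 + r"] by (cases r) auto
  have pc: "snd s5 b i = 0" for i
    using s5A(1)[of b] assms(2)[of b] by simp
  have rep: "config_rep m b n p (snd s5) ?c"
    using m reg pc by (simp add: config_rep_def proc_rep_def init_config_def)
  let ?st = "simulate_step m b P"
  have as: "r \<notin> assigned ?st" if "r \<notin> {20..27}" for r
    using simulate_step_simps(1)[of m b P] that by blast
  define J where "J i t \<longleftrightarrow> fst t 0 = 0 \<and> fst t 1 = 1 \<and> fst t 11 = p \<and> i \<le> T \<and>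
    config_rep m b n p (snd t) ((pram_step P p ^^ (T - i)) ?c)" for i and t :: state
  have J0: "J (fst s5 12) s5" using s5 rep by (simp add: J_def)
  have step2: "J i (run ?st (dec 12 t)) \<and> cost ?st (dec 12 t) \<le> 4 + p * (7 + 25 * length P)"
    if J: "J (Suc i) t" and k: "fst t 12 = Suc i" for i t
  proof -
    have *: "fst (dec 12 t) 0 = 0" "fst (dec 12 t) 1 = 1" "fst (dec 12 t) 11 = p"
      "config_rep m b n p (snd (dec 12 t)) ((pram_step P p ^^ (T - Suc i)) ?c)"
      using J by (auto simp: J_def)
    note st = simulate_step_run[OF * n assms(3)]
    have "T - i = Suc (T - Suc i)" using J unfolding J_def by linarith
    then show ?thesis using st J by (simp add: J_def run_unassigned[OF as])
  qed
  have 2: "J 0 (run (For 12 ?st) s5)" "cost (For 12 ?st) s5 \<le> 1 + fst s5 12 * (1 + (4 + p * (7 + 25 * length P)))"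
    by (rule For_rule[of 12 ?st J, OF _ J0 step2]; use as in simp)+
  have run: "run (simulate m b P k e) s = run (For 12 ?st) s5"
    and cost: "cost (simulate m b P k e) s =
      5 + cost (power_com 10 11 k) s1 + cost (power_com 10 12 e) s2 + 1 + cost (For 20 ?ini) s4 + cost (For 12 ?st) s5"
    unfolding simulate_def s5_def s4_def s3_def s2_def s1_def by simp_all
  show "snd (run (simulate m b P k e) s) m =
      snd ((pram_step P ((length w + 2) ^ k) ^^ ((length w + 2) ^ e)) ?c)"
    using 2(1) unfolding run J_def config_rep_def p_def T_def x_def by simp
  have "cost (simulate m b P k e) s \<le>
      5 + (1 + k * (4 + 2 * x)) + (1 + e * (4 + 2 * x)) + 1 + (1 + p * 2) + (1 + T * (1 + (4 + p * (7 + 25 * length P))))"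
    unfolding cost using c1 c2 1(2) 2(2) unfolding s4(5) s5(4) by (intro add_mono order_refl; simp)
  also have "\<dots> = 10 + (k + e) * (8 + 2 * length w) + 2 * p + T * (5 + p * (7 + 25 * length P))"
    by (simp add: x_def algebra_simps)
  finally show "cost (simulate m b P k e) s \<le> 10 + (k + e) * (8 + 2 * length w) + 2 * (length w + 2) ^ k +
       (length w + 2) ^ e * (5 + (length w + 2) ^ k * (7 + 25 * length P))"
    unfolding p_def T_def x_def .
qed

section \<open>Polynomial bounds\<close>

text \<open>No constant factor is needed, since a base of at least 2 absorbs it. The bound is thus a
  pure power, which \<open>power_com\<close> can compute as a number of rounds.\<close>

definition poly_in :: "('x \<Rightarrow> nat) \<Rightarrow> ('x \<Rightarrow> nat) \<Rightarrow> bool" where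
  "poly_in s f \<longleftrightarrow> (\<exists>e. \<forall>x. f x \<le> (s x + 2) ^ e)"

lemma poly_in_mono: "poly_in s g \<Longrightarrow> (\<And>x. f x \<le> g x) \<Longrightarrow> poly_in s f"
  unfolding poly_in_def by (meson order_trans)

lemma poly_in_const: "poly_in s (\<lambda>_. c)"
proof -
  have "c \<le> (s x + 2) ^ c" for x
  proof -
    have "c \<le> 2 ^ c" by (rule less_imp_le) (rule less_exp)
    also have "\<dots> \<le> (s x + 2) ^ c" by (rule power_mono) auto
    finally show ?thesis .
  qed
  then show ?thesis unfolding poly_in_def by blast
qed

lemma poly_in_size: "poly_in s s"
  unfolding poly_in_def by (rule exI[of _ 1]) simp

lemma poly_in_mult:
  assumes "poly_in s f" "poly_in s g"
  shows "poly_in s (\<lambda>x. f x * g x)"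
proof -
  obtain d e where "\<And>x. f x \<le> (s x + 2) ^ d" "\<And>x. g x \<le> (s x + 2) ^ e"
    using assms unfolding poly_in_def by blast
  then have "f x * g x \<le> (s x + 2) ^ (d + e)" for x
    unfolding power_add by (rule mult_le_mono)
  then show ?thesis unfolding poly_in_def by blast
qed

text \<open>Reduced to products by \<open>f + g \<le> (f + 1) * (g + 1)\<close>; the added 1 costs
  one more factor, as the base is at least 2.\<close>

lemma poly_in_add:
  assumes "poly_in s f" "poly_in s g"
  shows "poly_in s (\<lambda>x. f x + g x)"
proof (rule poly_in_mono)
  show "poly_in s (\<lambda>x. (f x + 1) * (g x + 1))"
  proof -
    have *: "poly_in s (\<lambda>x. h x + 1)" if h: "poly_in s h" for h
    proof -
      obtain d where d: "\<And>x. h x \<le> (s x + 2) ^ d"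
        using h unfolding poly_in_def by blast
      have "h x + 1 \<le> (s x + 2) ^ Suc d" for x
      proof -
        have "h x + 1 \<le> 2 * (s x + 2) ^ d"
          using d[of x] one_le_power[of "s x + 2" d] by linarith
        also have "\<dots> \<le> (s x + 2) * (s x + 2) ^ d" by (rule mult_le_mono1) simp
        finally show ?thesis by simp
      qed
      then show ?thesis unfolding poly_in_def by blast
    qed
    show ?thesis by (intro poly_in_mult * assms)
  qed
qed simp

lemma poly_in_power: "poly_in s f \<Longrightarrow> poly_in s (\<lambda>x. f x ^ k)"
proof (induction k)
  case 0
  show ?case unfolding power_0 by (rule poly_in_const)
next
  case (Suc k)
  then show ?case unfolding power_Suc using poly_in_mult by blast
qed

lemmas poly_in_intros = poly_in_const poly_in_add poly_in_mult poly_in_power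

text \<open>The common weakening of NC and polynomial time on which the simulation works:
  polylogarithmic time is polynomial, and a single processor is \<open>(n + 2) ^ 0\<close>.\<close>

definition poly_pram :: "('i \<Rightarrow> nat list) \<Rightarrow> ('o \<Rightarrow> nat list) \<Rightarrow> ('i \<Rightarrow> 'o) \<Rightarrow> bool" where
  "poly_pram ein eout f \<longleftrightarrow>
     (\<exists>P k e. \<forall>x. \<exists>M. pram_run P ((length (ein x) + 2) ^ k) ((length (ein x) + 2) ^ e)
         (input_memory (ein x)) M \<and> output_memory M (eout (f x)))"

lemma pram_run_mono: "pram_run P p t M M' \<Longrightarrow> t \<le> u \<Longrightarrow> pram_run P p u M M'"
  unfolding pram_run_def by (meson order_trans)

lemma poly_in_real:
  assumes "\<And>x. real (f x) \<le> C * (real (s x) + 2) ^ e"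
  shows "poly_in s f"
proof (rule poly_in_mono)
  show "poly_in s (\<lambda>x. nat \<lceil>C\<rceil> * (s x + 2) ^ e)"
    by (intro poly_in_intros poly_in_size)
  fix x
  have "C \<le> real (nat \<lceil>C\<rceil>)" by linarith
  then have "C * (real (s x) + 2) ^ e \<le> real (nat \<lceil>C\<rceil>) * (real (s x) + 2) ^ e"
    by (rule mult_right_mono) simp
  also have "\<dots> = real (nat \<lceil>C\<rceil> * (s x + 2) ^ e)"
    by (simp only: of_nat_mult of_nat_power of_nat_add of_nat_numeral)
  finally have "real (f x) \<le> real (nat \<lceil>C\<rceil> * (s x + 2) ^ e)"
    using assms[of x] by linarith
  then show "f x \<le> nat \<lceil>C\<rceil> * (s x + 2) ^ e" by (simp only: of_nat_le_iff)
qed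

lemma polylog_bounded_poly_in:
  assumes "polylog_bounded UNIV f s"
  shows "poly_in s f"
proof -
  obtain C e where C: "\<And>x. real (f x) \<le> C * log 2 (real (s x) + 2) ^ e"
    using assms by (auto simp: polylog_bounded_def)
  \<comment> \<open>The sign of \<open>C\<close> is not given, hence the absolute value.\<close>
  have "real (f x) \<le> \<bar>C\<bar> * (real (s x) + 2) ^ e" for x
  proof -
    have "log 2 (real (s x) + 2) \<le> real (s x) + 2"
    proof -
      have "real (s x + 2) < 2 ^ (s x + 2)"
        using less_exp[of "s x + 2"] by (metis of_nat_less_iff of_nat_numeral of_nat_power)
      then have "log 2 (real (s x) + 2) \<le> log 2 (2 ^ (s x + 2))"
        by (subst log_le_cancel_iff) auto
      also have "\<dots> = real (s x) + 2" by (subst log_nat_power) auto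
      finally show ?thesis .
    qed
    moreover have "0 \<le> log 2 (real (s x) + 2)" by simp
    ultimately have "log 2 (real (s x) + 2) ^ e \<le> (real (s x) + 2) ^ e"
      and "0 \<le> log 2 (real (s x) + 2) ^ e"
      by (auto intro: power_mono)
    then have "C * log 2 (real (s x) + 2) ^ e \<le> \<bar>C\<bar> * (real (s x) + 2) ^ e"
      by (intro mult_mono) auto
    with C[of x] show ?thesis by linarith
  qed
  then show ?thesis by (rule poly_in_real)
qed

lemma nc_computable_poly_pram:
  assumes "nc_computable ein eout f"
  shows "poly_pram ein eout f"
proof -
  obtain P k time where t: "polylog_bounded UNIV time (\<lambda>x. length (ein x))"
    and run: "\<And>x. \<exists>M. pram_run P ((length (ein x) + 2) ^ k) (time x) (input_memory (ein x)) M \<and>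
      output_memory M (eout (f x))"
    using assms unfolding nc_computable_def by blast
  obtain e where "\<And>x. time x \<le> (length (ein x) + 2) ^ e"
    using polylog_bounded_poly_in[OF t] unfolding poly_in_def by blast
  with run show ?thesis unfolding poly_pram_def by (meson pram_run_mono)
qed

lemma poly_time_fun_poly_pram:
  assumes "poly_time_fun f"
  shows "poly_pram enc_word enc_word f"
proof -
  obtain P time where t: "poly_bounded UNIV time (length :: 'a list \<Rightarrow> nat)"
    and run: "\<And>x. \<exists>M. pram_run P 1 (time x) (input_memory (enc_word x)) M \<and>
      output_memory M (enc_word (f x))"
    using assms unfolding poly_time_fun_def by blast
  have "poly_in length time"
    using t unfolding poly_bounded_def by (auto intro: poly_in_real)
  then obtain e where "\<And>x. time x \<le> (length (enc_word x) + 2) ^ e"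
    unfolding poly_in_def enc_word_def length_map by blast
  with run have "\<exists>M. pram_run P ((length (enc_word x) + 2) ^ 0) ((length (enc_word x) + 2) ^ e)
      (input_memory (enc_word x)) M \<and> output_memory M (enc_word (f x))" for x
    unfolding power_0 using pram_run_mono by blast
  then show ?thesis unfolding poly_pram_def by blast
qed

text \<open>A PRAM cannot fill more cells than it has processor steps, so it has no output of superpolynomial length.\<close>

lemma mem_step_support:
  assumes "finite {a. M a \<noteq> 0}"
  shows "finite {a. mem_step P p (S, M) a \<noteq> 0} \<and>
    card {a. mem_step P p (S, M) a \<noteq> 0} \<le> card {a. M a \<noteq> 0} + p"
  using assms
proof (induction p arbitrary: M)
  case 0
  then show ?case by (simp add: mem_step_0)
next
  case (Suc p)
  let ?M = "store_effect P (S p) M"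
  have "\<exists>a. {a. ?M a \<noteq> 0} \<subseteq> insert a {a. M a \<noteq> 0}"
    by (auto simp: store_effect_def split: instr.split)
  then obtain a where a: "{a. ?M a \<noteq> 0} \<subseteq> insert a {a. M a \<noteq> 0}" ..
  then have "finite {a. ?M a \<noteq> 0}" using Suc.prems finite_subset by blast
  moreover have "card {a. ?M a \<noteq> 0} \<le> Suc (card {a. M a \<noteq> 0})"
    using card_mono[OF _ a] Suc.prems card_insert_le_m1 by (simp add: card_insert_if split: if_splits)
  ultimately show ?case
    using Suc.IH[of ?M] by (simp add: mem_step_Suc)
qed

text \<open>The length cell itself may be set to a huge number, so the bound comes from counting
  nonblank cells: the symbols of \<open>w'\<close> are nonzero, the input fills at most
  \<open>length w + 1\<close> cells, and each step adds at most \<open>p\<close>.\<close>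

lemma pram_output_length:
  assumes "pram_run P p t (input_memory w) M" "output_memory M w'" "0 \<notin> set w'"
  shows "length w' \<le> length w + 1 + t * p"
proof -
  obtain t' where t': "t' \<le> t" "M = snd ((pram_step P p ^^ t') (init_config (input_memory w)))"
    using assms(1) by (auto simp: pram_run_def Let_def)
  define M' where "M' n = snd ((pram_step P p ^^ n) (init_config (input_memory w)))" for n
  have M'_Suc: "\<exists>S. M' (Suc n) = mem_step P p (S, M' n)" for n
    unfolding M'_def by (intro exI[of _ "fst ((pram_step P p ^^ n) (init_config (input_memory w)))"])
      (simp add: pram_step_def[of P p "(pram_step P p ^^ n) c" for c])
  have "finite {a. M' n a \<noteq> 0} \<and> card {a. M' n a \<noteq> 0} \<le> length w + 1 + n * p" for n
  proof (induction n)
    case 0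
    have "{a. M' 0 a \<noteq> 0} \<subseteq> {..length w}"
      by (auto simp: M'_def init_config_def input_memory_def split: if_splits)
    with finite_subset[OF this] card_mono[OF _ this] show ?case by simp
  next
    case (Suc n)
    obtain S where S: "M' (Suc n) = mem_step P p (S, M' n)"
      using M'_Suc by blast
    show ?case
      using Suc mem_step_support[of "M' n" P p S] unfolding S mult_Suc by linarith
  qed
  from this[of t'] have fin: "finite {a. M a \<noteq> 0}" and card: "card {a. M a \<noteq> 0} \<le> length w + 1 + t' * p"
    unfolding t'(2) M'_def by blast+
  have "Suc ` {..<length w'} \<subseteq> {a. M a \<noteq> 0}"
  proof
    fix a assume "a \<in> Suc ` {..<length w'}"
    then obtain i where i: "a = Suc i" "i < length w'" by blast
    then have "M a = w' ! i" using assms(2) by (simp add: output_memory_def)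
    with nth_mem[OF i(2)] assms(3) show "a \<in> {a. M a \<noteq> 0}" by (metis mem_Collect_eq)
  qed
  from card_mono[OF fin this] have "length w' \<le> card {a. M a \<noteq> 0}"
    by (simp add: card_image)
  also have "\<dots> \<le> length w + 1 + t * p"
    using card mult_le_mono1[OF t'(1), of p] by linarith
  finally show ?thesis .
qed

section \<open>Polynomial-time word functions\<close>

text \<open>
  The input is in array 0. The program leaves the arrays below \<open>N\<close> alone and expects the others
  to be blank, so programs can be run one after the other without interference.
\<close>

definition word_fun :: "('a::finite list \<Rightarrow> nat list) \<Rightarrow> bool" where
  "word_fun g \<longleftrightarrow> poly_in length (\<lambda>x. length (g x)) \<and>
     (\<forall>N\<ge>1. \<exists>c N' j T. N \<le> N' \<and> j < N' \<and> wf_com c \<and> arrays c \<subseteq> {..<N'} \<and> updated c \<subseteq> {N..} \<and>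
        poly_in length T \<and>
        (\<forall>x s. output_memory (snd s 0) (enc_word x) \<longrightarrow> (\<forall>i\<ge>N. snd s i = (\<lambda>_. 0)) \<longrightarrow>
           output_memory (snd (run c s) j) (g x) \<and> cost c s \<le> T x))"

lemma word_funI:
  assumes "poly_in length (\<lambda>x. length (g x))"
    and "\<And>N. 1 \<le> N \<Longrightarrow> \<exists>c N' j T. N \<le> N' \<and> j < N' \<and> wf_com c \<and> arrays c \<subseteq> {..<N'} \<and>
        updated c \<subseteq> {N..} \<and> poly_in length T \<and>
        (\<forall>x s. output_memory (snd s 0) (enc_word x) \<longrightarrow> (\<forall>i\<ge>N. snd s i = (\<lambda>_. 0)) \<longrightarrow>
           output_memory (snd (run c s) j) (g x) \<and> cost c s \<le> T x)"
  shows "word_fun g"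
  using assms unfolding word_fun_def by blast

lemma word_funE:
  assumes "word_fun g" "1 \<le> N"
  obtains c N' j T where "N \<le> N'" "j < N'" "wf_com c" "arrays c \<subseteq> {..<N'}" "updated c \<subseteq> {N..}"
    "poly_in length T"
    "\<And>x s. output_memory (snd s 0) (enc_word x) \<Longrightarrow> (\<And>i. N \<le> i \<Longrightarrow> snd s i = (\<lambda>_. 0)) \<Longrightarrow>
       output_memory (snd (run c s) j) (g x) \<and> cost c s \<le> T x"
proof -
  from assms have "\<exists>c N' j T. N \<le> N' \<and> j < N' \<and> wf_com c \<and> arrays c \<subseteq> {..<N'} \<and>
      updated c \<subseteq> {N..} \<and> poly_in length T \<and>
      (\<forall>x s. output_memory (snd s 0) (enc_word x) \<longrightarrow> (\<forall>i\<ge>N. snd s i = (\<lambda>_. 0)) \<longrightarrow>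
         output_memory (snd (run c s) j) (g x) \<and> cost c s \<le> T x)"
    unfolding word_fun_def by blast
  then show ?thesis using that by blast
qed

lemma word_fun_length: "word_fun g \<Longrightarrow> poly_in length (\<lambda>x. length (g x))"
  by (simp add: word_fun_def)

lemma word_fun_enc_word: "word_fun enc_word"
proof (rule word_funI)
  show "poly_in length (\<lambda>x. length (enc_word x))"
    by (simp add: enc_word_def poly_in_size)
next
  fix N :: nat assume "1 \<le> N"
  then show "\<exists>c N' j T. N \<le> N' \<and> j < N' \<and> wf_com c \<and> arrays c \<subseteq> {..<N'} \<and>
        updated c \<subseteq> {N..} \<and> poly_in length T \<and>
        (\<forall>x s. output_memory (snd s 0) (enc_word x) \<longrightarrow> (\<forall>i\<ge>N. snd s i = (\<lambda>_. 0)) \<longrightarrow>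
           output_memory (snd (run c s) j) (enc_word x) \<and> cost c s \<le> T x)"
    by - (rule exI[of _ "SetC 0 0"], rule exI[of _ N], rule exI[of _ 0], rule exI[of _ "\<lambda>_. 1"], simp add: poly_in_const)
qed

lemma word_fun_singleton: "word_fun (\<lambda>_. [v])"
proof (rule word_funI)
  show "poly_in length (\<lambda>x. length [v])" by (rule poly_in_const)
next
  fix N :: nat
  have "output_memory (snd (run (SetC 3 v ;; push N 3) s) N) [v]" if "snd s N = (\<lambda>_. 0)" for s
    using push_run[of "run (SetC 3 v) s" N "[]" 3] that output_memory_input_memory[of "[v]"]
    by (simp add: input_memory_Nil)
  then show "\<exists>c N' j T. N \<le> N' \<and> j < N' \<and> wf_com c \<and> arrays c \<subseteq> {..<N'} \<and>
        updated c \<subseteq> {N..} \<and> poly_in length T \<and>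
        (\<forall>x s. output_memory (snd s 0) (enc_word x) \<longrightarrow> (\<forall>i\<ge>N. snd s i = (\<lambda>_. 0)) \<longrightarrow>
           output_memory (snd (run c s) j) [v] \<and> cost c s \<le> T x)"
    by - (rule exI[of _ "SetC 3 v ;; push N 3"], rule exI[of _ "Suc N"], rule exI[of _ N], rule exI[of _ "\<lambda>_. 7"],
      simp add: poly_in_const del: run.simps)
qed

text \<open>The second program works above the arrays of the first, so the first result survives.
  Neither writes the input in array 0, because \<open>1 \<le> N\<close>. The blank arrays from
  \<open>N'\<close> on leave room for combining the results.\<close>

lemma word_fun_pairE:
  fixes g h :: "'a::finite list \<Rightarrow> nat list"
  assumes "word_fun g" "word_fun h" "1 \<le> N"
  obtains c N' j j' T where "N \<le> N'" "j < N'" "j' < N'" "wf_com c" "arrays c \<subseteq> {..<N'}"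
    "updated c \<subseteq> {N..}" "poly_in length T"
    "\<And>x s. output_memory (snd s 0) (enc_word x) \<Longrightarrow> (\<And>i. N \<le> i \<Longrightarrow> snd s i = (\<lambda>_. 0)) \<Longrightarrow>
       output_memory (snd (run c s) j) (g x) \<and> output_memory (snd (run c s) j') (h x) \<and> cost c s \<le> T x \<and>
       (\<forall>i\<ge>N'. snd (run c s) i = (\<lambda>_. 0))"
proof -
  obtain c1 N1 j1 T1 where 1: "N \<le> N1" "j1 < N1" "wf_com c1" "arrays c1 \<subseteq> {..<N1}"
    "updated c1 \<subseteq> {N..}" "poly_in length T1"
    "\<And>x s. output_memory (snd s 0) (enc_word x) \<Longrightarrow> (\<And>i. N \<le> i \<Longrightarrow> snd s i = (\<lambda>_. 0)) \<Longrightarrow>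
       output_memory (snd (run c1 s) j1) (g x) \<and> cost c1 s \<le> T1 x"
    by (rule word_funE[OF assms(1,3)]) blast
  have "1 \<le> N1" using assms(3) 1(1) by simp
  obtain c2 N2 j2 T2 where 2: "N1 \<le> N2" "j2 < N2" "wf_com c2" "arrays c2 \<subseteq> {..<N2}"
    "updated c2 \<subseteq> {N1..}" "poly_in length T2"
    "\<And>x s. output_memory (snd s 0) (enc_word x) \<Longrightarrow> (\<And>i. N1 \<le> i \<Longrightarrow> snd s i = (\<lambda>_. 0)) \<Longrightarrow>
       output_memory (snd (run c2 s) j2) (h x) \<and> cost c2 s \<le> T2 x"
    by (rule word_funE[OF assms(2) \<open>1 \<le> N1\<close>]) blast
  show ?thesis
  proof (rule that[of N2 j1 j2 "c1 ;; c2" "\<lambda>x. T1 x + T2 x"])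
    show "N \<le> N2" "j1 < N2" "j2 < N2" "wf_com (c1 ;; c2)" "arrays (c1 ;; c2) \<subseteq> {..<N2}"
      "updated (c1 ;; c2) \<subseteq> {N..}" "poly_in length (\<lambda>x. T1 x + T2 x)"
      using 1 2 by (auto intro: poly_in_add)
    fix x :: "'a list" and s :: state
    assume x: "output_memory (snd s 0) (enc_word x)" and s: "\<And>i. N \<le> i \<Longrightarrow> snd s i = (\<lambda>_. 0)"
    have un1: "snd (run c1 s) i = snd s i" if "i < N \<or> N1 \<le> i" for i
      using that 1(4,5) updated_subset_arrays[of c1] by (intro run_not_updated) fastforce
    have un2: "snd (run c2 t) i = snd t i" if "i < N1 \<or> N2 \<le> i" for i t
      using that 2(4,5) updated_subset_arrays[of c2] by (intro run_not_updated) fastforce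
    have "output_memory (snd (run c1 s) 0) (enc_word x)"
      using un1[of 0] assms(3) x by simp
    moreover have "snd (run c1 s) i = (\<lambda>_. 0)" if "N1 \<le> i" for i
      using that un1[of i] s[of i] 1(1) by simp
    ultimately have "output_memory (snd (run c2 (run c1 s)) j2) (h x) \<and> cost c2 (run c1 s) \<le> T2 x"
      by (rule 2(7))
    moreover have "snd (run c2 (run c1 s)) j1 = snd (run c1 s) j1" using un2 1(2) by simp
    moreover have "snd (run c2 (run c1 s)) i = (\<lambda>_. 0)" if "N2 \<le> i" for i
      using that un2[of i] un1[of i] s[of i] 1(1) 2(1) by simp
    ultimately show "output_memory (snd (run (c1 ;; c2) s) j1) (g x) \<and>
      output_memory (snd (run (c1 ;; c2) s) j2) (h x) \<and> cost (c1 ;; c2) s \<le> T1 x + T2 x \<and>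
       (\<forall>i\<ge>N2. snd (run (c1 ;; c2) s) i = (\<lambda>_. 0))"
      using 1(7)[OF x s] by auto
  qed
qed

lemma word_fun_append:
  assumes "word_fun g" "word_fun h"
  shows "word_fun (\<lambda>x. g x @ h x)"
proof (rule word_funI)
  show "poly_in length (\<lambda>x. length (g x @ h x))"
    using assms[THEN word_fun_length] by (simp add: poly_in_add)
next
  fix N :: nat assume N: "1 \<le> N"
  obtain c N' j j' T where c: "N \<le> N'" "j < N'" "j' < N'" "wf_com c" "arrays c \<subseteq> {..<N'}"
    "updated c \<subseteq> {N..}" "poly_in length T"
    "\<And>x s. output_memory (snd s 0) (enc_word x) \<Longrightarrow> (\<And>i. N \<le> i \<Longrightarrow> snd s i = (\<lambda>_. 0)) \<Longrightarrow>
       output_memory (snd (run c s) j) (g x) \<and> output_memory (snd (run c s) j') (h x) \<and> cost c s \<le> T x \<and>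
       (\<forall>i\<ge>N'. snd (run c s) i = (\<lambda>_. 0))"
    by (rule word_fun_pairE[OF assms N]) blast
  let ?c = "c ;; append_word N' j ;; append_word N' j'"
  let ?T = "\<lambda>x. T x + (8 + 9 * length (g x) + 9 * length (h x))"
  have "output_memory (snd (run ?c s) N') (g x @ h x) \<and> cost ?c s \<le> ?T x"
    if x: "output_memory (snd s 0) (enc_word x)" and s: "\<forall>i\<ge>N. snd s i = (\<lambda>_. 0)" for x s
  proof -
    have s1: "output_memory (snd (run c s) j) (g x)" "output_memory (snd (run c s) j') (h x)"
      "cost c s \<le> T x" "snd (run c s) N' = input_memory []"
      using c(8)[OF x] s by (auto simp: input_memory_Nil)
    have a1: "snd (run (append_word N' j) (run c s)) = (snd (run c s))(N' := input_memory (g x))"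
      "cost (append_word N' j) (run c s) \<le> 4 + 9 * length (g x)"
      using append_word_run[OF s1(4,1)] c(2) by auto
    have a2: "snd (run (append_word N' j') (run (append_word N' j) (run c s))) =
        (snd (run c s))(N' := input_memory (g x @ h x))"
      "cost (append_word N' j') (run (append_word N' j) (run c s)) \<le> 4 + 9 * length (h x)"
      using append_word_run[of "run (append_word N' j) (run c s)" N' "g x" j' "h x"] c(3) s1(2)
      unfolding a1(1) by auto
    show ?thesis
      using a1(2) a2 s1(3) by (simp add: output_memory_input_memory)
  qed
  moreover have "poly_in length ?T"
    using c(7) assms[THEN word_fun_length] by (intro poly_in_intros)
  ultimately show "\<exists>c N' j T. N \<le> N' \<and> j < N' \<and> wf_com c \<and> arrays c \<subseteq> {..<N'} \<and>
        updated c \<subseteq> {N..} \<and> poly_in length T \<and>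
        (\<forall>x s. output_memory (snd s 0) (enc_word x) \<longrightarrow> (\<forall>i\<ge>N. snd s i = (\<lambda>_. 0)) \<longrightarrow>
           output_memory (snd (run c s) j) (g x @ h x) \<and> cost c s \<le> T x)"
    using c(1-6)
    by - (rule exI[of _ ?c], rule exI[of _ "Suc N'"], rule exI[of _ N'], rule exI[of _ ?T], auto)
qed

lemma word_fun_eq:
  assumes "word_fun g" "word_fun h"
  shows "word_fun (\<lambda>x. enc_bool (g x = h x))"
proof (rule word_funI)
  show "poly_in length (\<lambda>x. length (enc_bool (g x = h x)))"
    by (rule poly_in_mono[OF poly_in_const[of _ 1]]) (simp add: enc_bool_def)
next
  fix N :: nat assume N: "1 \<le> N"
  obtain c N' j j' T where c: "N \<le> N'" "j < N'" "j' < N'" "wf_com c" "arrays c \<subseteq> {..<N'}"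
    "updated c \<subseteq> {N..}" "poly_in length T"
    "\<And>x s. output_memory (snd s 0) (enc_word x) \<Longrightarrow> (\<And>i. N \<le> i \<Longrightarrow> snd s i = (\<lambda>_. 0)) \<Longrightarrow>
       output_memory (snd (run c s) j) (g x) \<and> output_memory (snd (run c s) j') (h x) \<and> cost c s \<le> T x \<and>
       (\<forall>i\<ge>N'. snd (run c s) i = (\<lambda>_. 0))"
    by (rule word_fun_pairE[OF assms N]) blast
  let ?c = "c ;; compare_words N' j j'"
  let ?T = "\<lambda>x. T x + (11 + 8 * length (g x))"
  have "output_memory (snd (run ?c s) N') (enc_bool (g x = h x)) \<and> cost ?c s \<le> ?T x"
    if x: "output_memory (snd s 0) (enc_word x)" and s: "\<forall>i\<ge>N. snd s i = (\<lambda>_. 0)" for x s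
  proof -
    have s1: "output_memory (snd (run c s) j) (g x)" "output_memory (snd (run c s) j') (h x)"
      "cost c s \<le> T x"
      using c(8)[OF x] s by auto
    show ?thesis
      using compare_words_run[OF s1(1,2), of N'] s1(3) by simp
  qed
  moreover have "poly_in length ?T"
    using c(7) assms[THEN word_fun_length] by (intro poly_in_intros)
  ultimately show "\<exists>c N' j T. N \<le> N' \<and> j < N' \<and> wf_com c \<and> arrays c \<subseteq> {..<N'} \<and>
        updated c \<subseteq> {N..} \<and> poly_in length T \<and>
        (\<forall>x s. output_memory (snd s 0) (enc_word x) \<longrightarrow> (\<forall>i\<ge>N. snd s i = (\<lambda>_. 0)) \<longrightarrow>
           output_memory (snd (run c s) j) (enc_bool (g x = h x)) \<and> cost c s \<le> T x)"
    using c(1-6)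
    by - (rule exI[of _ ?c], rule exI[of _ "Suc N'"], rule exI[of _ N'], rule exI[of _ ?T], auto)
qed

text \<open>A truth value is the word \<open>[1]\<close> or \<open>[]\<close>, so the concatenation
  of two of them is \<open>[1, 1]\<close> exactly if both hold. Conjunction thus reduces to equality
  of words.\<close>

lemma word_fun_conj:
  assumes "word_fun (\<lambda>x. enc_bool (p x))" "word_fun (\<lambda>x. enc_bool (q x))"
  shows "word_fun (\<lambda>x. enc_bool (p x \<and> q x))"
proof -
  have "word_fun (\<lambda>x. enc_bool (enc_bool (p x) @ enc_bool (q x) = [1] @ [1]))"
    by (intro word_fun_eq word_fun_append word_fun_singleton assms)
  moreover have "(enc_bool a @ enc_bool b = [1] @ [1]) = (a \<and> b)" for a b
    by (simp add: enc_bool_def)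
  ultimately show ?thesis by simp
qed

text \<open>This is closure under composition. The intermediate word is copied into the blank array
  \<open>N'\<close>, because a PRAM expects blank cells behind its input; symbols other than 0 in
  the output keep its length polynomial.\<close>

lemma word_fun_pram:
  assumes "poly_pram ein eout f" "word_fun (\<lambda>x. ein (h x))" "\<And>y. 0 \<notin> set (eout y)"
  shows "word_fun (\<lambda>x. eout (f (h x)))"
proof -
  obtain P k e where run: "\<And>y. \<exists>M. pram_run P ((length (ein y) + 2) ^ k) ((length (ein y) + 2) ^ e)
         (input_memory (ein y)) M \<and> output_memory M (eout (f y))"
    using assms(1) unfolding poly_pram_def by blast
  let ?n = "\<lambda>x. length (ein (h x))"
  have n: "poly_in length ?n" using assms(2) by (rule word_fun_length)
  have len: "length (eout (f (h x))) \<le> ?n x + 1 + (?n x + 2) ^ e * (?n x + 2) ^ k" for x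
    using run[of "h x"] pram_output_length assms(3) by blast
  show ?thesis
  proof (rule word_funI)
    show "poly_in length (\<lambda>x. length (eout (f (h x))))"
      by (rule poly_in_mono[OF _ len]) (intro poly_in_intros n)
  next
    fix N :: nat assume N: "1 \<le> N"
    obtain c N' j T where c: "N \<le> N'" "j < N'" "wf_com c" "arrays c \<subseteq> {..<N'}"
      "updated c \<subseteq> {N..}" "poly_in length T"
      "\<And>x s. output_memory (snd s 0) (enc_word x) \<Longrightarrow> (\<And>i. N \<le> i \<Longrightarrow> snd s i = (\<lambda>_. 0)) \<Longrightarrow>
         output_memory (snd (run c s) j) (ein (h x)) \<and> cost c s \<le> T x"
      by (rule word_funE[OF assms(2) N]) blast
    obtain R where R: "prog_regs P \<subseteq> {..<R}"
      using finite_prog_regs[of P] finite_nat_set_iff_bounded by (metis lessThan_iff subsetI)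
    let ?sim = "simulate N' (Suc N') P k e"
    let ?c = "c ;; append_word N' j ;; ?sim"
    let ?S = "\<lambda>x. 10 + (k + e) * (8 + 2 * ?n x) + 2 * (?n x + 2) ^ k +
       (?n x + 2) ^ e * (5 + (?n x + 2) ^ k * (7 + 25 * length P))"
    let ?T = "\<lambda>x. T x + (4 + 9 * ?n x) + ?S x"
    have "output_memory (snd (run ?c s) N') (eout (f (h x))) \<and> cost ?c s \<le> ?T x"
      if x: "output_memory (snd s 0) (enc_word x)" and s: "\<forall>i\<ge>N. snd s i = (\<lambda>_. 0)" for x s
    proof -
      have blank: "snd (run c s) i = (\<lambda>_. 0)" if "N' \<le> i" for i
      proof -
        have "snd (run c s) i = snd s i"
          using that c(4) updated_subset_arrays[of c] by (intro run_not_updated) fastforce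
        then show ?thesis using that s c(1) by simp
      qed
      have s1: "output_memory (snd (run c s) j) (ein (h x))" "cost c s \<le> T x"
        "snd (run c s) N' = input_memory []"
        using c(7)[OF x] s blank[of N'] by (auto simp: input_memory_Nil)
      define s2 where "s2 = run (append_word N' j) (run c s)"
      have s2: "snd s2 = (snd (run c s))(N' := input_memory (ein (h x)))"
        and c2: "cost (append_word N' j) (run c s) \<le> 4 + 9 * ?n x"
        using append_word_run[OF s1(3,1)] c(2) by (auto simp: s2_def)
      have sim: "snd (run ?sim s2) N' = snd ((pram_step P ((?n x + 2) ^ k) ^^ ((?n x + 2) ^ e))
            (init_config (input_memory (ein (h x)))))"
        "cost ?sim s2 \<le> ?S x"
        by (rule simulate_run; use s2 blank in simp)+
      obtain M where M: "pram_run P ((?n x + 2) ^ k) ((?n x + 2) ^ e) (input_memory (ein (h x))) M"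
        "output_memory M (eout (f (h x)))"
        using run by blast
      have "snd (run ?sim s2) N' = M"
        unfolding sim(1) by (rule pram_run_final[OF M(1) order_refl])
      with M(2) have "output_memory (snd (run ?c s) N') (eout (f (h x)))"
        by (simp add: s2_def)
      moreover have "cost ?c s = cost c s + cost (append_word N' j) (run c s) + cost ?sim s2"
        by (simp add: s2_def)
      then have "cost ?c s \<le> ?T x"
        using s1(2) c2 sim(2) by linarith
      ultimately show ?thesis ..
    qed
    moreover have "poly_in length ?T"
      by (intro poly_in_intros n c(6))
    \<comment> \<open>The simulator always uses array \<open>N' + 3\<close> for register 0 of the
      processors, and \<open>N' + 3 + r\<close> for each register \<open>r < R\<close>.\<close>
    moreover have "arrays ?c \<subseteq> {..<N' + 4 + R}"
    proof -
      have "arrays ?sim \<subseteq> {N', Suc N', Suc N' + 1, Suc N' + 2} \<union> (\<lambda>r. Suc N' + 2 + r) ` {..<R}"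
        using simulate_simps(1)[of N' "Suc N'" P k e] R by blast
      also have "\<dots> \<subseteq> {..<N' + 4 + R}" by auto
      finally show ?thesis using c(2,4) by auto
    qed
    moreover have "updated ?c \<subseteq> {N..}"
      using simulate_simps(2)[of N' "Suc N'" P k e] c(1,5) by fastforce
    ultimately show "\<exists>c N' j T. N \<le> N' \<and> j < N' \<and> wf_com c \<and> arrays c \<subseteq> {..<N'} \<and>
        updated c \<subseteq> {N..} \<and> poly_in length T \<and>
        (\<forall>x s. output_memory (snd s 0) (enc_word x) \<longrightarrow> (\<forall>i\<ge>N. snd s i = (\<lambda>_. 0)) \<longrightarrow>
           output_memory (snd (run c s) j) (eout (f (h x))) \<and> cost c s \<le> T x)"
      using c(1,3)
      by - (rule exI[of _ ?c], rule exI[of _ "N' + 4 + R"], rule exI[of _ N'], rule exI[of _ ?T], simp)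
  qed
qed

section \<open>Polynomial-time decisions as preprocessing\<close>

lemma sym_code_bij: "bij_betw (sym_code :: 'a::finite \<Rightarrow> nat) UNIV {2..card (UNIV :: 'a set) + 1}"
  unfolding sym_code_def
  using someI_ex[OF finite_same_card_bij[of "UNIV :: 'a set" "{2..card (UNIV :: 'a set) + 1}"]]
  by simp

lemma sym_code_ge_2: "2 \<le> sym_code (x :: 'a::finite)"
  using bij_betw_apply[OF sym_code_bij, of x] by simp

lemma enc_word_eq_iff: "enc_word v = enc_word w \<longleftrightarrow> v = w"
  unfolding enc_word_def by (rule inj_map_eq_map) (rule bij_betw_imp_inj_on[OF sym_code_bij])

lemma enc_word_ge_2: "n \<in> set (enc_word w) \<Longrightarrow> 2 \<le> n"
  by (auto simp: enc_word_def sym_code_ge_2)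

primrec times_com :: "nat \<Rightarrow> com" where
  "times_com 0 = SetC 7 0"
| "times_com (Suc K) = times_com K ;; AddC 7 7 5"

lemma times_com_simps [simp]:
  "run (times_com K) s = ((fst s)(7 := fst s 5 * K), snd s)" "cost (times_com K) s = Suc K"
  "assigned (times_com K) = {7}" "arrays (times_com K) = {}" "wf_com (times_com K)"
  by (induction K) auto

text \<open>Running downwards, so that every cell is read before it can be overwritten.\<close>

definition spread :: "nat \<Rightarrow> com" where
  "spread K =
     (SetC 0 0 ;; SetC 1 1 ;; Get 4 0 0 ;; AddC 4 4 1) ;;
     For 4 (AddC 5 4 0 ;; Get 6 0 5 ;; Put 0 5 0 ;; times_com K ;; Put 0 7 6)"

lemma spread_simps [simp]: "arrays (spread K) = {0}" "wf_com (spread K)"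
  by (auto simp: spread_def)

text \<open>Code compiled for \<open>K\<close> arrays finds array 0 at the multiples of
  \<open>K\<close>, while the input lies in consecutive cells. Cell \<open>k\<close> moves to
  \<open>k * K\<close>, which is never below \<open>k\<close>, so cells not yet moved stay intact;
  all gaps become blank arrays.\<close>

lemma spread_run:
  assumes "snd s 0 = input_memory w" "1 \<le> K"
  shows "snd (run (spread K) s) 0 (i * K) = input_memory w i"
    "0 < j \<Longrightarrow> j < K \<Longrightarrow> snd (run (spread K) s) 0 (i * K + j) = 0"
    "cost (spread K) s \<le> 5 + (length w + 1) * (6 + K)"
proof -
  let ?body = "AddC 5 4 0 ;; Get 6 0 5 ;; Put 0 5 0 ;; times_com K ;; Put 0 7 6"
  let ?inp = "input_memory w"
  define s1 where "s1 = run (SetC 0 0 ;; SetC 1 1 ;; Get 4 0 0 ;; AddC 4 4 1) s"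
  have s1: "fst s1 0 = 0" "fst s1 4 = Suc (length w)" "snd s1 = snd s"
    using assms(1) by (auto simp: s1_def input_memory_def)
  \<comment> \<open>Below \<open>k\<close> the memory is still the input, from \<open>k\<close> on
    it is final. The start \<open>k = length w + 1\<close> qualifies because everything there is
    blank.\<close>
  define I where "I k t \<longleftrightarrow> fst t 0 = 0 \<and> (\<forall>a<k. snd t 0 a = ?inp a) \<and>
    (\<forall>i\<ge>k. snd t 0 (i * K) = ?inp i) \<and> (\<forall>a\<ge>k. (\<forall>i\<ge>k. a \<noteq> i * K) \<longrightarrow> snd t 0 a = 0)"
    for k and t :: state
  have blank: "?inp a = 0" if "length w < a" for a
    using that by (simp add: input_memory_def)
  have "length w < i * K" if "length w < i" for i
    using that assms(2) by (metis less_le_trans mult.right_neutral mult_le_mono2)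
  then have I0: "I (fst s1 4) s1"
    using s1 assms(1) blank by (auto simp: I_def)
  have step: "I k (run ?body (dec 4 t)) \<and> cost ?body (dec 4 t) \<le> 5 + K"
    if I: "I (Suc k) t" and t: "fst t 4 = Suc k" for k t
  proof -
    let ?M = "snd t 0"
    \<comment> \<open>The source is cleared before the target is written: for \<open>k = 0\<close>
      or \<open>K = 1\<close> they are the same cell.\<close>
    have M: "snd (run ?body (dec 4 t)) 0 = ?M(k := 0, k * K := ?M k)"
      "fst (run ?body (dec 4 t)) 0 = 0"
      using I t by (auto simp: I_def)
    have kK: "k \<le> k * K" using assms(2) by simp
    have "(?M(k := 0, k * K := ?M k)) a = ?inp a" if "a < k" for a
      using that I kK by (auto simp: I_def)
    moreover have "(?M(k := 0, k * K := ?M k)) (i * K) = ?inp i" if "k \<le> i" for i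
    proof (cases "i = k")
      case True
      then show ?thesis using I by (simp add: I_def)
    next
      case False
      then have "Suc k \<le> i" "i * K \<noteq> k * K" using that assms(2) by auto
      moreover have "i \<le> i * K" using assms(2) by simp
      ultimately have "i * K \<noteq> k" by linarith
      then show ?thesis using I \<open>Suc k \<le> i\<close> \<open>i * K \<noteq> k * K\<close> by (simp add: I_def)
    qed
    moreover have "(?M(k := 0, k * K := ?M k)) a = 0"
      if "k \<le> a" "\<forall>i\<ge>k. a \<noteq> i * K" for a
    proof (cases "a = k")
      case True
      then show ?thesis using that by simp
    next
      case False
      then have "Suc k \<le> a" "\<forall>i\<ge>Suc k. a \<noteq> i * K" "a \<noteq> k * K" using that by auto
      then show ?thesis using I False unfolding I_def by simp
    qed
    ultimately have "I k (run ?body (dec 4 t))"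
      using M unfolding I_def by simp
    then show ?thesis by simp
  qed
  have *: "I 0 (run (For 4 ?body) s1)" "cost (For 4 ?body) s1 \<le> 1 + fst s1 4 * (1 + (5 + K))"
    by (rule For_rule[of 4 ?body I, OF _ I0 step]; simp)+
  have run: "run (spread K) s = run (For 4 ?body) s1"
    and cost: "cost (spread K) s = 4 + cost (For 4 ?body) s1"
    unfolding spread_def s1_def by simp_all
  show "snd (run (spread K) s) 0 (i * K) = ?inp i"
    using *(1) unfolding run I_def by blast
  show "snd (run (spread K) s) 0 (i * K + j) = 0" if "0 < j" "j < K"
  proof -
    have "i * K + j \<noteq> i' * K" for i'
      using that by (metis add.commute add_0 less_numeral_extra(3) mod_less mod_mult_self1 mod_mult_self2_is_0)
    then show ?thesis using *(1) unfolding run I_def by simp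
  qed
  show "cost (spread K) s \<le> 5 + (length w + 1) * (6 + K)"
    using *(2) unfolding cost s1(2) by simp
qed

text \<open>Cell \<open>j\<close> is entry 0 of array \<open>j\<close> in the interleaved layout,
  that is, the length of the encoded truth value. It is read before cells 0 and 1 receive the
  output, and complemented because the empty word is to mean yes.\<close>

definition answer :: "nat \<Rightarrow> nat \<Rightarrow> com" where
  "answer j v = SetC 0 0 ;; SetC 1 1 ;; SetC 3 j ;; Get 2 0 3 ;; SetC 3 v ;; Put 0 1 3 ;;
     SubC 2 1 2 ;; Put 0 0 2"

lemma reaches_pram_run:
  assumes "reaches P t ((0, \<lambda>_. 0), M) ((pc, \<rho>), M')" "length P \<le> pc"
  shows "pram_run P 1 t M M'"
proof -
  obtain t' where t': "t' \<le> t" "(ram_step P ^^ t') ((0, \<lambda>_. 0), M) = ((pc, \<rho>), M')"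
    using assms(1) by (auto simp: reaches_def)
  have "(fst ((pram_step P 1 ^^ t') (init_config M)) 0, snd ((pram_step P 1 ^^ t') (init_config M)))
     = ((pc, \<rho>), M')"
    unfolding pram_steps_one using t'(2) by (simp add: init_config_def fun_upd_idem)
  then show ?thesis
    using t'(1) assms(2) by (auto simp: pram_run_def proc_halted_def Let_def)
qed

text \<open>Three code fragments with strides 1, \<open>K\<close> and 1 run one after the other on
  the same registers and memory; in between only the reading of the memory as arrays
  changes.\<close>

lemma word_fun_poly_time:
  fixes v :: "'a::finite"
  assumes "word_fun (\<lambda>x :: 'a list. enc_bool (p x))"
  shows "poly_time_fun (\<lambda>x :: 'a list. if p x then [] else [v])"
proof -
  obtain c K j T where c: "1 \<le> K" "j < K" "wf_com c" "arrays c \<subseteq> {..<K}" "poly_in length T"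
    "\<And>(x :: 'a list) s. output_memory (snd s 0) (enc_word x) \<Longrightarrow> (\<And>i. 1 \<le> i \<Longrightarrow> snd s i = (\<lambda>_. 0)) \<Longrightarrow>
       output_memory (snd (run c s) j) (enc_bool (p x)) \<and> cost c s \<le> T x"
    by (rule word_funE[OF assms order_refl]) blast
  define C1 where "C1 = compile 1 1 (spread K)"
  define C2 where "C2 = compile K (1 + length C1) c"
  define C3 where "C3 = compile 1 (1 + length C1 + length C2) (answer j (sym_code v))"
  \<comment> \<open>The first instruction establishes the constant 1 in register 1 that compiled
    code relies on.\<close>
  define P where "P = [Const 1 1] @ C1 @ C2 @ C3"
  let ?T = "\<lambda>x :: 'a list. 1 + (1 + 3) * (5 + (length x + 1) * (6 + K)) + (K + 3) * T x + (1 + 3) * 8"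
  have "code_at P 1 C1" "code_at P (1 + length C1) C2" "code_at P (1 + length C1 + length C2) C3"
    unfolding P_def using code_at_infix[of "[Const 1 1]" C1 "C2 @ C3"] code_at_infix[of "[Const 1 1] @ C1" C2 C3]
      code_at_infix[of "[Const 1 1] @ C1 @ C2" C3 "[]"] by (simp_all add: add.assoc)
  note at = this
  have wf: "wf_com (spread K)" "arrays (spread K) \<subseteq> {..<1}"
    "wf_com (answer j (sym_code v))" "arrays (answer j (sym_code v)) \<subseteq> {..<1}"
    by (auto simp: answer_def)
  have "\<exists>M. pram_run P 1 (?T x) (input_memory (enc_word x)) M \<and>
      output_memory M (enc_word (if p x then [] else [v]))" for x :: "'a list"
  proof -
    let ?M = "input_memory (enc_word x)"
    let ?\<rho> = "(\<lambda>_. 0)(1 := 1)"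
    define s1 :: state where "s1 = (\<lambda>_. 0, \<lambda>_. ?M)"
    have "represents 1 ?\<rho> ?M s1" by (simp add: represents_def s1_def)
    then obtain \<rho>1 M1 where 1: "represents 1 \<rho>1 M1 (run (spread K) s1)"
      "reaches P ((1 + 3) * cost (spread K) s1) ((1, ?\<rho>), ?M) ((1 + length C1, \<rho>1), M1)"
      using compile_correct[OF wf(1,2) at(1)[unfolded C1_def]] unfolding C1_def[symmetric] by blast
    have M1: "M1 a = snd (run (spread K) s1) 0 a" for a
      using 1(1) by (simp add: represents_def)
    have "snd s1 0 = ?M" by (simp add: s1_def)
    note spread = spread_run[OF this c(1)]
    \<comment> \<open>The spread memory, read with stride \<open>K\<close>: the input in array 0,
      all other arrays blank.\<close>
    define s2 :: state where "s2 = (fst (run (spread K) s1), \<lambda>j. if j = 0 then ?M else (\<lambda>_. 0))"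
    have "represents K \<rho>1 M1 s2"
      using 1(1) spread(1,2) M1 by (auto simp: represents_def s2_def)
    then obtain \<rho>2 M2 where 2: "represents K \<rho>2 M2 (run c s2)"
      "reaches P ((K + 3) * cost c s2) ((1 + length C1, \<rho>1), M1) ((1 + length C1 + length C2, \<rho>2), M2)"
      using compile_correct[OF c(3,4) at(2)[unfolded C2_def]] unfolding C2_def[symmetric] by blast
    have dec: "output_memory (snd (run c s2) j) (enc_bool (p x)) \<and> cost c s2 \<le> T x"
      by (rule c(6)) (simp_all add: s2_def output_memory_input_memory)
    have M2: "M2 j = (if p x then 1 else 0)"
    proof -
      have "M2 (0 * K + j) = snd (run c s2) j 0"
        using 2(1) c(2) unfolding represents_def by blast
      then show ?thesis using dec by (simp add: output_memory_def enc_bool_def split: if_splits)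
    qed
    \<comment> \<open>Back to stride 1, where the whole memory is array 0.\<close>
    define s3 :: state where "s3 = (fst (run c s2), \<lambda>_. M2)"
    have "represents 1 \<rho>2 M2 s3"
      using 2(1) by (simp add: represents_def s3_def)
    then obtain \<rho>3 M3 where 3: "represents 1 \<rho>3 M3 (run (answer j (sym_code v)) s3)"
      "reaches P ((1 + 3) * cost (answer j (sym_code v)) s3) ((1 + length C1 + length C2, \<rho>2), M2)
        ((1 + length C1 + length C2 + length C3, \<rho>3), M3)"
      using compile_correct[OF wf(3,4) at(3)[unfolded C3_def]] unfolding C3_def[symmetric] by blast
    have "M3 a = snd (run (answer j (sym_code v)) s3) 0 a" for a
      using 3(1) by (simp add: represents_def)
    then have "M3 0 = (if p x then 0 else 1)" "M3 1 = sym_code v"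
      by (auto simp: answer_def s3_def M2)
    then have out: "output_memory M3 (enc_word (if p x then [] else [v]))"
      by (simp add: output_memory_def enc_word_def)
    have "reaches P 1 ((0, \<lambda>_. 0), ?M) ((1, ?\<rho>), ?M)"
      by (rule reaches_one) (simp add: ram_step_eq P_def)
    from reaches_trans[OF reaches_trans[OF reaches_trans[OF this 1(2)] 2(2)] 3(2)]
    have "reaches P (1 + (1 + 3) * cost (spread K) s1 + (K + 3) * cost c s2 + (1 + 3) * cost (answer j (sym_code v)) s3)
        ((0, \<lambda>_. 0), ?M) ((1 + length C1 + length C2 + length C3, \<rho>3), M3)" .
    moreover have "1 + (1 + 3) * cost (spread K) s1 + (K + 3) * cost c s2 + (1 + 3) * cost (answer j (sym_code v)) s3 \<le> ?T x"
      using spread(3) dec by (intro add_mono mult_le_mono2 order_refl) (simp_all add: answer_def enc_word_def)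
    ultimately have "reaches P (?T x) ((0, \<lambda>_. 0), ?M) ((1 + length C1 + length C2 + length C3, \<rho>3), M3)"
      by (rule reaches_mono)
    then have "pram_run P 1 (?T x) ?M M3"
      by (rule reaches_pram_run) (simp add: P_def)
    with out show ?thesis by blast
  qed
  moreover have "poly_bounded UNIV ?T (length :: 'a list \<Rightarrow> nat)"
  proof -
    have "poly_in length ?T"
      by (intro poly_in_intros poly_in_size c(5))
    then obtain e where "\<And>x. ?T x \<le> (length x + 2) ^ e" unfolding poly_in_def by blast
    then have "real (?T x) \<le> real ((length x + 2) ^ e)" for x :: "'a list"
      by (simp only: of_nat_le_iff)
    moreover have "real ((length x + 2) ^ e) = 1 * (real (length x) + 2) ^ e" for x :: "'a list"
      by (simp only: of_nat_power of_nat_add of_nat_numeral mult_1)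
    ultimately show ?thesis unfolding poly_bounded_def by (metis (no_types, lifting))
  qed
  ultimately show ?thesis
    unfolding poly_time_fun_def by (intro exI[of _ P] exI[of _ ?T] conjI allI)
qed

section \<open>Constant-time programs for the new factorization\<close>

lemma nc_computable_constant_time:
  assumes "\<And>x. \<exists>M. pram_run P 1 t (input_memory (ein x)) M \<and> output_memory M (eout (f x))"
  shows "nc_computable ein eout f"
proof -
  have "polylog_bounded UNIV (\<lambda>_. t) (\<lambda>x. length (ein x))"
    unfolding polylog_bounded_def by (intro exI[of _ "real t"] exI[of _ 0]) simp
  then show ?thesis
    unfolding nc_computable_def using assms
    by (intro exI[of _ P] exI[of _ 0] exI[of _ "\<lambda>_. t"]) simp
qed

lemma nc_fun_id: "nc_fun (\<lambda>x. x)"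
  unfolding nc_fun_def
proof (rule nc_computable_constant_time)
  fix x :: "'a list"
  have "pram_run [] 1 0 (input_memory (enc_word x)) (input_memory (enc_word x))"
    by (rule reaches_pram_run[OF reaches_refl]) simp
  then show "\<exists>M. pram_run [] 1 0 (input_memory (enc_word x)) M \<and> output_memory M (enc_word x)"
    using output_memory_input_memory by blast
qed

lemma nc_fun_Nil: "nc_fun (\<lambda>_. [])"
  unfolding nc_fun_def
proof (rule nc_computable_constant_time)
  fix x :: "'a list"
  let ?P = "[Store 0 0]" and ?M = "input_memory (enc_word x)"
  have "reaches ?P 1 ((0, \<lambda>_. 0), ?M) ((1, \<lambda>_. 0), ?M(0 := 0))"
    by (rule reaches_one) (simp add: ram_step_eq)
  then have "pram_run ?P 1 1 ?M (?M(0 := 0))"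
    by (rule reaches_pram_run) simp
  then show "\<exists>M. pram_run ?P 1 1 ?M M \<and> output_memory M (enc_word [])"
    by (auto simp: output_memory_def enc_word_def)
qed

text \<open>Symbols have codes from 2 on, so \<open>y\<close> is empty exactly if the last symbol of
  the encoded pair is the separator 1. Then shortening the word by one leaves \<open>x\<close>;
  otherwise length 0 is written. Extracting \<open>x\<close> from an arbitrary pair would require
  finding the separator.\<close>

lemma nc_fun2_first: "nc_fun2 (\<lambda>x y. if y = [] then x else [])"
  unfolding nc_fun2_def
proof (rule nc_computable_constant_time)
  fix z :: "'a list \<times> 'a list"
  obtain x y where z: "z = (x, y)" by (cases z)
  \<comment> \<open>Register 0 of processor 0 is 0: it is the address of the length, the value for
    the empty word and the condition of the unconditional jump to 9. Both branches take 7
    steps.\<close>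
  let ?P = "[Load 1 0, Load 2 1, Const 3 1, Sub 2 2 3, JumpZero 2 7, Store 0 0, JumpZero 0 9,
    Sub 1 1 3, Store 0 1]"
  let ?M = "input_memory (enc_pair z)"
  let ?n = "length (enc_pair z)"
  let ?M' = "?M(0 := if y = [] then ?n - 1 else 0)"
  have n: "?M 0 = ?n" by (simp add: input_memory_def)
  have last: "?M ?n = 1 \<longleftrightarrow> y = []" "1 \<le> ?M ?n"
  proof -
    have "?M ?n = last (enc_pair z)"
      by (simp add: input_memory_def enc_pair_def last_conv_nth)
    moreover have "2 \<le> last (enc_word y)" if "y \<noteq> []"
      using that by (intro enc_word_ge_2[of _ y] last_in_set) (simp add: enc_word_def)
    moreover have "enc_word y = [] \<longleftrightarrow> y = []" by (simp add: enc_word_def)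
    ultimately show "?M ?n = 1 \<longleftrightarrow> y = []" "1 \<le> ?M ?n"
      by (cases "y = []"; simp add: enc_pair_def z)+
  qed
  have "\<exists>\<rho>. reaches ?P 7 ((0, \<lambda>_. 0), ?M) ((9, \<rho>), ?M')"
  proof (cases "y = []")
    case True
    then have "\<exists>\<rho>. (ram_step ?P ^^ 7) ((0, \<lambda>_. 0), ?M) = ((9, \<rho>), ?M')"
      using n last by (simp add: eval_nat_numeral ram_step_eq)
    then show ?thesis unfolding reaches_def by blast
  next
    case False
    then have "?M ?n - Suc 0 \<noteq> 0" using last by auto
    then have "\<exists>\<rho>. (ram_step ?P ^^ 7) ((0, \<lambda>_. 0), ?M) = ((9, \<rho>), ?M')"
      using n False by (simp add: eval_nat_numeral ram_step_eq)
    then show ?thesis unfolding reaches_def by blast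
  qed
  then obtain \<rho> where "reaches ?P 7 ((0, \<lambda>_. 0), ?M) ((9, \<rho>), ?M')" ..
  then have "pram_run ?P 1 7 ?M ?M'"
    by (rule reaches_pram_run) simp
  moreover have "output_memory ?M' (enc_word ((\<lambda>(x, y). if y = [] then x else []) z))"
    by (auto simp: z output_memory_def enc_pair_def enc_word_def input_memory_def nth_append)
  ultimately show "\<exists>M. pram_run ?P 1 7 ?M M \<and>
      output_memory M (enc_word ((\<lambda>(x, y). if y = [] then x else []) z))"
    by blast
qed

text \<open>The encoded pair of empty words is \<open>[1]\<close>, which is also the encoding of
  true. The program only has to test for length 1 and to reset the length otherwise.\<close>

lemma nc_pair_language_Nil: "nc_pair_language {([], [])}"
  unfolding nc_pair_language_def
proof (rule nc_computable_constant_time)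
  fix z :: "'a list \<times> 'a list"
  obtain x y where z: "z = (x, y)" by (cases z)
  let ?P = "[Load 1 0, Const 2 1, Sub 1 1 2, JumpZero 1 5, Store 0 0]"
  let ?M = "input_memory (enc_pair z)"
  let ?M' = "if z = ([], []) then ?M else ?M(0 := 0)"
  have n: "?M 0 = length x + length y + 1"
    by (simp add: input_memory_def enc_pair_def enc_word_def z)
  have "\<exists>\<rho>. reaches ?P 5 ((0, \<lambda>_. 0), ?M) ((5, \<rho>), ?M')"
  proof (cases "z = ([], [])")
    case True
    then have "\<exists>\<rho>. (ram_step ?P ^^ 4) ((0, \<lambda>_. 0), ?M) = ((5, \<rho>), ?M')"
      using n by (simp add: eval_nat_numeral ram_step_eq z)
    then show ?thesis unfolding reaches_def by (meson numeral_le_iff semiring_norm(68,71,72))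
  next
    case False
    then have "\<exists>\<rho>. (ram_step ?P ^^ 5) ((0, \<lambda>_. 0), ?M) = ((5, \<rho>), ?M')"
      using n by (auto simp: eval_nat_numeral ram_step_eq z)
    then show ?thesis unfolding reaches_def by blast
  qed
  then obtain \<rho> where "reaches ?P 5 ((0, \<lambda>_. 0), ?M) ((5, \<rho>), ?M')" ..
  then have "pram_run ?P 1 5 ?M ?M'"
    by (rule reaches_pram_run) simp
  moreover have "output_memory ?M' (enc_bool (z \<in> {([], [])}))"
    by (auto simp: z output_memory_def enc_bool_def enc_pair_def enc_word_def input_memory_def)
  ultimately show "\<exists>M. pram_run ?P 1 5 ?M M \<and> output_memory M (enc_bool (z \<in> {([], [])}))"
    by blast
qed

lemma decidable_can_be_made_tractable:
  fixes L :: "'a::finite list set"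
  assumes "word_fun (\<lambda>x. enc_bool (x \<in> L))"
  shows "can_be_made_tractable L"
proof -
  let ?\<rho> = "\<lambda>x y :: 'a list. if y = [] then x else []"
  let ?\<Upsilon> = "(\<lambda>x. x, \<lambda>_. [], ?\<rho>, 0) :: 'a factorization"
  \<comment> \<open>Any nonempty word could stand for no; \<open>undefined\<close> is just some
    letter.\<close>
  let ?\<Pi> = "\<lambda>x :: 'a list. if x \<in> L then [] else [undefined]"
  have zero: "polylog_bounded A (\<lambda>_. 0) g" for A :: "'x set" and g
    unfolding polylog_bounded_def by (intro exI[of _ 0]) simp
  have "cr_factorization L ?\<Upsilon>"
    using nc_fun_id nc_fun_Nil nc_fun2_first by (simp add: zero)
  moreover have "sqcap'_tractable (pair_language L ?\<Upsilon>)"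
    unfolding sqcap'_tractable_def
  proof (intro conjI exI)
    show "polylog_bounded (pair_language L ?\<Upsilon>) (\<lambda>(D, Q). length Q) (\<lambda>(D, Q). length D)"
      unfolding polylog_bounded_def by (intro exI[of _ 0]) auto
    show "poly_time_fun ?\<Pi>" by (rule word_fun_poly_time[OF assms])
    show "polylog_bounded UNIV (\<lambda>x. length (?\<Pi> x)) length"
      unfolding polylog_bounded_def by (intro exI[of _ 1] exI[of _ 0]) simp
    show "nc_pair_language ({([], [])} :: ('a list \<times> 'a list) set)" by (rule nc_pair_language_Nil)
    show "\<forall>D Q. (D, Q) \<in> pair_language L ?\<Upsilon> \<longleftrightarrow> (?\<Pi> D, Q) \<in> {([], [])}" by auto
  qed
  ultimately show ?thesis unfolding can_be_made_tractable_def by blast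
qed

section \<open>Tractable languages are decidable in polynomial time\<close>

lemma enc_word_no_zero: "0 \<notin> set (enc_word w)"
  using enc_word_ge_2[of 0 w] by auto

lemma word_fun_nc_fun:
  "nc_fun f \<Longrightarrow> word_fun (\<lambda>x. enc_word (u x)) \<Longrightarrow> word_fun (\<lambda>x. enc_word (f (u x)))"
  unfolding nc_fun_def by (rule word_fun_pram[OF nc_computable_poly_pram _ enc_word_no_zero])

lemma word_fun_enc_pair:
  assumes "word_fun (\<lambda>x. enc_word (u x))" "word_fun (\<lambda>x. enc_word (v x))"
  shows "word_fun (\<lambda>x. enc_pair (u x, v x))"
  unfolding enc_pair_def fst_conv snd_conv
  by (intro word_fun_append word_fun_singleton assms)

lemma word_fun_nc_fun2:
  assumes "nc_fun2 f" "word_fun (\<lambda>x. enc_word (u x))" "word_fun (\<lambda>x. enc_word (v x))"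
  shows "word_fun (\<lambda>x. enc_word (f (u x) (v x)))"
  using word_fun_pram[OF nc_computable_poly_pram[OF assms(1)[unfolded nc_fun2_def]]
      word_fun_enc_pair[OF assms(2,3)] enc_word_no_zero]
  by simp

lemma word_fun_enc_eq:
  assumes "word_fun (\<lambda>x. enc_word (u x))" "word_fun (\<lambda>x. enc_word (v x))"
  shows "word_fun (\<lambda>x. enc_bool (u x = v x))"
  using word_fun_eq[OF assms] by (simp add: enc_word_eq_iff)

lemma word_fun_tractable:
  assumes "sqcap'_tractable S" "word_fun (\<lambda>x. enc_word (u x))" "word_fun (\<lambda>x. enc_word (v x))"
  shows "word_fun (\<lambda>x. enc_bool ((u x, v x) \<in> S))"
proof -
  obtain \<Pi> S' where S: "poly_time_fun \<Pi>" "nc_pair_language S'" "\<And>D Q. (D, Q) \<in> S \<longleftrightarrow> (\<Pi> D, Q) \<in> S'"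
    using assms(1) unfolding sqcap'_tractable_def by blast
  have "word_fun (\<lambda>x. enc_word (\<Pi> (u x)))"
    by (rule word_fun_pram[OF poly_time_fun_poly_pram[OF S(1)] assms(2) enc_word_no_zero])
  from word_fun_pram[OF nc_computable_poly_pram[OF S(2)[unfolded nc_pair_language_def]]
      word_fun_enc_pair[OF this assms(3)]]
  show ?thesis by (simp add: S(3) enc_bool_def)
qed

text \<open>A word outside \<open>L\<close> may have the same parts as some \<open>y\<close> in
  \<open>L\<close>. Then \<open>\<rho>\<close> returns \<open>y\<close>, so the equation with
  \<open>x\<close> fails.\<close>

lemma cr_factorization_mem_iff:
  assumes "cr_factorization L (\<pi>1, \<pi>2, \<rho>, c)"
  shows "x \<in> L \<longleftrightarrow> \<rho> (\<pi>1 x) (\<pi>2 x) = x \<and> (\<pi>1 x, \<pi>2 x) \<in> pair_language L (\<pi>1, \<pi>2, \<rho>, c)"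
  using assms by fastforce

text \<open>A preimage of the pair in \<open>L\<close> can only be \<open>\<rho> D Q\<close>, so the
  existential quantifier becomes a test of one computable candidate.\<close>

lemma pair_language_mem_iff:
  assumes "cr_factorization L (\<pi>1, \<pi>2, \<rho>, c)"
  shows "(D, Q) \<in> pair_language L (\<pi>1, \<pi>2, \<rho>, c) \<longleftrightarrow>
    \<rho> D Q \<in> L \<and> \<pi>1 (\<rho> D Q) = D \<and> \<pi>2 (\<rho> D Q) = Q"
proof -
  have "\<rho> (\<pi>1 x) (\<pi>2 x) = x" if "x \<in> L" for x
    using assms that by simp
  moreover have "(D, Q) \<in> pair_language L (\<pi>1, \<pi>2, \<rho>, c) \<longleftrightarrow> (\<exists>x\<in>L. \<pi>1 x = D \<and> \<pi>2 x = Q)"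
    by auto
  ultimately show ?thesis by metis
qed

text \<open>Stated for a computed word \<open>u x\<close>, since the reduction asks about membership
  in \<open>L2\<close> of a word obtained from the input.\<close>

lemma can_be_made_tractable_decidable:
  assumes "can_be_made_tractable L" "word_fun (\<lambda>x. enc_word (u x))"
  shows "word_fun (\<lambda>x. enc_bool (u x \<in> L))"
proof -
  obtain \<pi>1 \<pi>2 \<rho> c where cr: "cr_factorization L (\<pi>1, \<pi>2, \<rho>, c)"
    and S: "sqcap'_tractable (pair_language L (\<pi>1, \<pi>2, \<rho>, c))"
    using assms(1) unfolding can_be_made_tractable_def by (metis prod_cases4)
  have nc: "nc_fun \<pi>1" "nc_fun \<pi>2" "nc_fun2 \<rho>" using cr by auto
  show ?thesis
    unfolding cr_factorization_mem_iff[OF cr]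
    by (intro word_fun_conj word_fun_enc_eq word_fun_tractable[OF S] word_fun_nc_fun2[OF nc(3)]
        word_fun_nc_fun[OF nc(1)] word_fun_nc_fun[OF nc(2)] assms(2))
qed

theorem theorem2:
  fixes L1 L2 :: "'a::finite list set"
  assumes "nc_fcr_reducible L1 L2"
    and "can_be_made_tractable L2"
  shows "can_be_made_tractable L1"
proof (rule decidable_can_be_made_tractable)
  obtain \<Upsilon>1 \<Upsilon>2 \<alpha> \<beta> where "cr_factorization L1 \<Upsilon>1" "cr_factorization L2 \<Upsilon>2" and nc: "nc_fun \<alpha>" "nc_fun \<beta>"
    and "\<And>D Q. (D, Q) \<in> pair_language L1 \<Upsilon>1 \<longleftrightarrow> (\<alpha> D, \<beta> Q) \<in> pair_language L2 \<Upsilon>2"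
    using assms(1) unfolding nc_fcr_reducible_def by blast
  then obtain \<pi>1 \<pi>2 \<rho> c \<pi>1' \<pi>2' \<rho>' c' where
    cr: "cr_factorization L1 (\<pi>1, \<pi>2, \<rho>, c)" "cr_factorization L2 (\<pi>1', \<pi>2', \<rho>', c')"
    and red: "\<And>D Q. (D, Q) \<in> pair_language L1 (\<pi>1, \<pi>2, \<rho>, c) \<longleftrightarrow>
      (\<alpha> D, \<beta> Q) \<in> pair_language L2 (\<pi>1', \<pi>2', \<rho>', c')"
    by (metis prod_cases4)
  have nc12: "nc_fun \<pi>1" "nc_fun \<pi>2" "nc_fun2 \<rho>" "nc_fun \<pi>1'" "nc_fun \<pi>2'" "nc_fun2 \<rho>'"
    using cr by auto
  show "word_fun (\<lambda>x. enc_bool (x \<in> L1))"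
    \<comment> \<open>For \<open>y = \<rho>' (\<alpha> (\<pi>1 x)) (\<beta> (\<pi>2 x))\<close>,
      membership of \<open>x\<close> in \<open>L1\<close> becomes: \<open>\<rho>\<close> restores
      \<open>x\<close>, \<open>y\<close> is in \<open>L2\<close>, and \<open>\<pi>1'\<close>,
      \<open>\<pi>2'\<close> split \<open>y\<close> into the two arguments of
      \<open>\<rho>'\<close>. Each conjunct is a polynomial-time test.\<close>
    unfolding cr_factorization_mem_iff[OF cr(1)] red pair_language_mem_iff[OF cr(2)]
    by (intro word_fun_conj word_fun_enc_eq can_be_made_tractable_decidable[OF assms(2)]
        word_fun_nc_fun2[OF nc12(3)] word_fun_nc_fun2[OF nc12(6)] word_fun_nc_fun[OF nc12(1)]
        word_fun_nc_fun[OF nc12(2)] word_fun_nc_fun[OF nc12(4)] word_fun_nc_fun[OF nc12(5)]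
        word_fun_nc_fun[OF nc(1)] word_fun_nc_fun[OF nc(2)] word_fun_enc_word)
qed

end
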